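(* Fix an integer $n\ge 2$, and let $\mathbb{K}'$ be the set of smoothly bounded, strongly convex, balanced domains $Y\subset\mathbb{C}^n$. If $\Psi:\mathbb{K}'\to\mathbb{E}_0$ is a $\mathrm{GL}_n(\mathbb{C})$ equivariant map, i.e. $\Psi(AY)=A\Psi(Y)$ whenever $A\in\mathrm{GL}_n(\mathbb{C})$ and $Y\in\mathbb{K}'$, then there are a complex manifold $S$ and a pseudoconvex family $X\subset S\times\mathbb{C}^n$ all of whose fibers $X[s]$, $s\in S$, are in $\mathbb{K}'$, but such that $$\bigcup_{s\in S}\big(\{s\}\times\Psi(X[s])\big)\subset S\times\mathbb{C}^n$$ is not a pseudoconvex family.
   Context: $\mathbb{E}_0$ denotes the set of hermitian ellipsoids in $\mathbb{C}^n$, i.e. the images of the open unit ball of $\mathbb{C}^n$ under invertible complex linear maps $\mathbb{C}^n\to\mathbb{C}^n$. A set $Y\subset\mathbb{C}^n$ is balanced if $y\in Y$, $\zeta\in\mathbb{C}$, $|\zeta|\le 1$ imply $\zeta y\in Y$. Strong convexity of $Y$ means that the normal curvatures of $\partial Y$ are positive. Thus the elements of $\mathbb{K}'$ are the open unit balls of those norms $\|\cdot\|$ on the complex vector space $\mathbb{C}^n$ that are smooth away from $0$ and for which the real Hessian of $\|\cdot\|^2$ is positive definite away from $0$. For a complex manifold $S$, an open set $X\subset S\times\mathbb{C}^n$ and $s\in S$, the fiber is $X[s]=\{x\in\mathbb{C}^n:(s,x)\in X\}$. A family of pseudoconvex open sets over $S$ is an open set $X\subset S\times\mathbb{C}^n$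 that contains $S\times\{0\}$ and such that each fiber $X[s]$, $s\in S$, is pseudoconvex. It is called a pseudoconvex family if in addition $X$ is a Stein manifold. *)

theory Defs
  imports "HOL-Analysis.Analysis"
begin

section \<open>Smoothly bounded, strongly convex, balanced domains and ellipsoids\<close>

primrec Ck_on :: "nat \<Rightarrow> ('a::real_normed_vector \<Rightarrow> real) \<Rightarrow> 'a set \<Rightarrow> bool" where
  "Ck_on 0 f U \<longleftrightarrow> continuous_on U f"
| "Ck_on (Suc k) f U \<longleftrightarrow> (\<forall>x\<in>U. f differentiable (at x)) \<and>
     (\<forall>v. Ck_on k (\<lambda>x. frechet_derivative f (at x) v) U)"

definition smooth_on :: "('a::real_normed_vector \<Rightarrow> real) \<Rightarrow> 'a set \<Rightarrow> bool" where
  "smooth_on f U \<longleftrightarrow> (\<forall>k. Ck_on k f U)"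

definition local_defining_function ::
  "'a::real_normed_vector set \<Rightarrow> 'a \<Rightarrow> 'a set \<Rightarrow> ('a \<Rightarrow> real) \<Rightarrow> bool" where
  "local_defining_function Y p U \<rho> \<longleftrightarrow>
     open U \<and> p \<in> U \<and> smooth_on \<rho> U \<and>
     (\<forall>x\<in>U. \<exists>v. frechet_derivative \<rho> (at x) v \<noteq> 0) \<and>
     Y \<inter> U = {x \<in> U. \<rho> x < 0}"

definition smoothly_bounded :: "'a::real_normed_vector set \<Rightarrow> bool" where
  "smoothly_bounded Y \<longleftrightarrow>
     bounded Y \<and> (\<forall>p\<in>frontier Y. \<exists>U \<rho>. local_defining_function Y p U \<rho>)"

text \<open>Normal curvature, with respect to the inner normal, of the hypersurface \<open>\<rho> = 0\<close> at \<open>p\<close> in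
  the tangent direction \<open>v\<close>. If \<open>c\<close> is a unit speed curve in the hypersurface with \<open>c 0 = p\<close> and
  velocity \<open>v\<close>, then differentiating \<open>\<rho> (c t) = 0\<close> twice gives
  \<open>D\<^sup>2\<rho>(v,v) + D\<rho>(c'') = 0\<close>, so the component of \<open>c''\<close> along the inner unit normal
  \<open>- grad \<rho> / |grad \<rho>|\<close> is \<open>D\<^sup>2\<rho>(v,v) / |grad \<rho>|\<close>. In particular the value does not depend on
  the choice of the defining function, so strong convexity may be tested with any one of them. The operator norm of the derivative is \<open>|grad \<rho>|\<close>.\<close>

definition normal_curvature :: "('a::euclidean_space \<Rightarrow> real) \<Rightarrow> 'a \<Rightarrow> 'a \<Rightarrow> real" where
  "normal_curvature \<rho> p v =
     frechet_derivative (\<lambda>x. frechet_derivative \<rho> (at x) v) (at p) v /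
       (onorm (frechet_derivative \<rho> (at p)) * (norm v)\<^sup>2)"

definition strongly_convex :: "'a::euclidean_space set \<Rightarrow> bool" where
  "strongly_convex Y \<longleftrightarrow>
     (\<forall>p\<in>frontier Y. \<exists>U \<rho>. local_defining_function Y p U \<rho> \<and>
        (\<forall>v. v \<noteq> 0 \<and> frechet_derivative \<rho> (at p) v = 0 \<longrightarrow> 0 < normal_curvature \<rho> p v))"

definition balanced :: "(complex^'n) set \<Rightarrow> bool" where
  "balanced Y \<longleftrightarrow> (\<forall>y\<in>Y. \<forall>\<zeta>. cmod \<zeta> \<le> 1 \<longrightarrow> \<zeta> *s y \<in> Y)"

definition \<K>' :: "(complex^'n) set set" where
  "\<K>' = {Y. open Y \<and> connected Y \<and> Y \<noteq> {} \<and>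
     smoothly_bounded Y \<and> strongly_convex Y \<and> balanced Y}"

definition hermitian_ellipsoids :: "(complex^'n) set set" where
  "hermitian_ellipsoids = {(\<lambda>x. A *v x) ` ball 0 1 | A :: complex^'n^'n. invertible A}"

section \<open>Pseudoconvex open sets\<close>

text \<open>The sub-mean value inequality over the boundaries of affine complex discs contained in \<open>D\<close>.\<close>

definition continuous_plurisubharmonic_on :: "(complex^'n \<Rightarrow> real) \<Rightarrow> (complex^'n) set \<Rightarrow> bool" where
  "continuous_plurisubharmonic_on u D \<longleftrightarrow> continuous_on D u \<and>
     (\<forall>z w. (\<forall>\<zeta>. cmod \<zeta> \<le> 1 \<longrightarrow> z + \<zeta> *s w \<in> D) \<longrightarrow>
        u z \<le> 1 / (2 * pi) * integral {0..2 * pi} (\<lambda>t. u (z + cis t *s w)))"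

definition pseudoconvex :: "(complex^'n) set \<Rightarrow> bool" where
  "pseudoconvex D \<longleftrightarrow> open D \<and>
     (\<exists>u. continuous_plurisubharmonic_on u D \<and> (\<forall>c. compact {z \<in> D. u z \<le> c}))"

section \<open>Complex manifolds\<close>

text \<open>For a finite index set \<open>I\<close>, the coordinate space \<open>\<complex>\<^sup>I\<close> is represented by the functions
  \<open>'i \<Rightarrow> complex\<close> that are \<open>undefined\<close> outside \<open>I\<close>, with the product topology. The dimension
  \<open>card I\<close> is thus a term and can be quantified over.\<close>

abbreviation coord_space :: "'i set \<Rightarrow> ('i \<Rightarrow> complex) topology" where
  "coord_space I \<equiv> product_topology (\<lambda>_. euclidean) I"

text \<open>Holomorphic functions of several variables on an open set: continuous and holomorphic in each
  variable separately.\<close>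

definition holo_on_coord :: "'i set \<Rightarrow> (('i \<Rightarrow> complex) \<Rightarrow> complex) \<Rightarrow> ('i \<Rightarrow> complex) set \<Rightarrow> bool" where
  "holo_on_coord I f V \<longleftrightarrow>
     continuous_map (subtopology (coord_space I) V) euclidean f \<and>
     (\<forall>z\<in>V. \<forall>i\<in>I. (\<lambda>w. f (z(i := w))) field_differentiable at (z i))"

record ('a, 'i) charted_space =
  points :: "'a topology"
  coords :: "'i set"
  charts :: "('a set \<times> ('a \<Rightarrow> 'i \<Rightarrow> complex)) set"

definition topological_chart :: "('a, 'i) charted_space \<Rightarrow> 'a set \<Rightarrow> ('a \<Rightarrow> 'i \<Rightarrow> complex) \<Rightarrow> bool" where
  "topological_chart M U \<phi> \<longleftrightarrow>
     openin (points M) U \<and> openin (coord_space (coords M)) (\<phi> ` U) \<and>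
     homeomorphic_map (subtopology (points M) U) (subtopology (coord_space (coords M)) (\<phi> ` U)) \<phi>"

definition holomorphic_transition ::
  "('a, 'i) charted_space \<Rightarrow> 'a set \<times> ('a \<Rightarrow> 'i \<Rightarrow> complex) \<Rightarrow> 'a set \<times> ('a \<Rightarrow> 'i \<Rightarrow> complex) \<Rightarrow> bool" where
  "holomorphic_transition M = (\<lambda>(U, \<phi>) (V, \<psi>). \<forall>i\<in>coords M.
     holo_on_coord (coords M) (\<lambda>z. \<psi> (inv_into U \<phi> z) i) (\<phi> ` (U \<inter> V)))"

text \<open>Manifolds are pure dimensional, Hausdorff and second countable; they need not be connected.
  Such a manifold has at most continuum many points, so up to isomorphism the points can be taken in
  any type of that cardinality, such as \<open>nat \<Rightarrow> complex\<close>.\<close>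

definition complex_manifold :: "('a, 'i) charted_space \<Rightarrow> bool" where
  "complex_manifold M \<longleftrightarrow>
     finite (coords M) \<and> Hausdorff_space (points M) \<and> second_countable (points M) \<and>
     (\<forall>(U, \<phi>)\<in>charts M. topological_chart M U \<phi>) \<and>
     (\<Union>(U, \<phi>)\<in>charts M. U) = topspace (points M) \<and>
     (\<forall>c\<in>charts M. \<forall>d\<in>charts M. holomorphic_transition M c d)"

definition holomorphic_fun :: "('a, 'i) charted_space \<Rightarrow> ('a \<Rightarrow> complex) \<Rightarrow> bool" where
  "holomorphic_fun M f \<longleftrightarrow>
     (\<forall>(U, \<phi>)\<in>charts M. holo_on_coord (coords M) (\<lambda>z. f (inv_into U \<phi> z)) (\<phi> ` U))"

text \<open>A chart of the maximal atlas.\<close>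

definition holomorphic_chart :: "('a, 'i) charted_space \<Rightarrow> 'a set \<Rightarrow> ('a \<Rightarrow> 'i \<Rightarrow> complex) \<Rightarrow> bool" where
  "holomorphic_chart M U \<phi> \<longleftrightarrow> topological_chart M U \<phi> \<and>
     (\<forall>c\<in>charts M. holomorphic_transition M c (U, \<phi>) \<and> holomorphic_transition M (U, \<phi>) c)"

definition open_submanifold :: "('a, 'i) charted_space \<Rightarrow> 'a set \<Rightarrow> ('a, 'i) charted_space" where
  "open_submanifold M X =
     \<lparr>points = subtopology (points M) X, coords = coords M,
      charts = (\<lambda>(U, \<phi>). (U \<inter> X, \<phi>)) ` charts M\<rparr>"

definition times_Cn :: "('a, 'i) charted_space \<Rightarrow> ('a \<times> (complex^'n), 'i + 'n) charted_space" where
  "times_Cn S =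
     \<lparr>points = prod_topology (points S) euclidean, coords = coords S <+> UNIV,
      charts = (\<lambda>(U, \<phi>). (U \<times> UNIV, \<lambda>(s, x). case_sum (\<phi> s) (\<lambda>j. x $ j))) ` charts S\<rparr>"

section \<open>Stein manifolds and pseudoconvex families\<close>

text \<open>The condition with \<open>B\<close> says that \<open>|f x|\<close> is at most the supremum of \<open>|f|\<close> on \<open>K\<close>; for
  compact \<open>K\<close> the set of upper bounds is non-empty, and the hull of the empty set is empty.\<close>

definition holomorphic_hull :: "('a, 'i) charted_space \<Rightarrow> 'a set \<Rightarrow> 'a set" where
  "holomorphic_hull M K = {x \<in> topspace (points M). \<forall>f B. holomorphic_fun M f \<longrightarrow>
     (\<forall>k\<in>K. cmod (f k) \<le> B) \<longrightarrow> cmod (f x) \<le> B}"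

definition stein_manifold :: "('a, 'i) charted_space \<Rightarrow> bool" where
  "stein_manifold M \<longleftrightarrow> complex_manifold M \<and>
     (\<forall>K. compactin (points M) K \<longrightarrow> compactin (points M) (holomorphic_hull M K)) \<and>
     (\<forall>x\<in>topspace (points M). \<forall>y\<in>topspace (points M). x \<noteq> y \<longrightarrow>
        (\<exists>f. holomorphic_fun M f \<and> f x \<noteq> f y)) \<and>
     (\<forall>x\<in>topspace (points M). \<exists>W F. x \<in> W \<and> (\<forall>i\<in>coords M. holomorphic_fun M (F i)) \<and>
        holomorphic_chart M W (\<lambda>y. \<lambda>i\<in>coords M. F i y))"

definition fiber :: "('a \<times> 'b) set \<Rightarrow> 'a \<Rightarrow> 'b set" where
  "fiber X s = {x. (s, x) \<in> X}"

definition family_of_pseudoconvex_open_sets ::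
  "('a, 'i) charted_space \<Rightarrow> ('a \<times> (complex^'n)) set \<Rightarrow> bool" where
  "family_of_pseudoconvex_open_sets S X \<longleftrightarrow>
     openin (prod_topology (points S) euclidean) X \<and>
     topspace (points S) \<times> {0} \<subseteq> X \<and>
     (\<forall>s\<in>topspace (points S). pseudoconvex (fiber X s))"

definition pseudoconvex_family ::
  "('a, 'i) charted_space \<Rightarrow> ('a \<times> (complex^'n)) set \<Rightarrow> bool" where
  "pseudoconvex_family S X \<longleftrightarrow>
     family_of_pseudoconvex_open_sets S X \<and> stein_manifold (open_submanifold (times_Cn S) X)"

end

theory Submission
  imports Defs "HOL-Complex_Analysis.Complex_Analysis"
begin

text \<open>Suppose that \<open>\<Psi>\<close> turns pseudoconvex families with fibers in \<open>\<K>'\<close> into pseudoconvex families. This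
  makes \<open>\<Psi>\<close> monotone in a weak sense. Let \<open>P\<close> and \<open>R\<close> be homogeneous quartics on \<open>\<complex>\<^sup>n\<close> that are upper
  envelopes of squared moduli of entire functions (sums of such squares, say), so that \<open>log P\<close> and
  \<open>log R\<close> are plurisubharmonic. Then \<open>X = {(s, x). P x + \<bar>s\<bar>\<^sup>2 R x < 1}\<close> over a disc \<open>\<bar>s\<bar> < \<rho>\<close>, \<open>\<rho> > 1\<close>, is
  holomorphically convex (\<open>stein_sublevel_family\<close>), and its fibers lie in \<open>\<K>'\<close> as long as the quartics
  \<open>P + \<bar>s\<bar>\<^sup>2 R\<close> have positive definite Hessians (\<open>quartic_sublevel_in_K'\<close>). The fiber \<open>X[s]\<close> depends only on
  \<open>\<bar>s\<bar>\<close>, hence so does \<open>\<Psi>(X[s])\<close>, and the continuity principle, applied in the Stein manifold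
  \<open>\<Union>\<^sub>s {s} \<times> \<Psi>(X[s])\<close> to the discs \<open>{(s, \<tau> x). \<bar>s\<bar> \<le> 1}\<close>, shows that \<open>\<Psi>(X[1]) \<subseteq> \<Psi>(X[0])\<close>. Thus
  \<open>\<Psi> {P + R < 1} \<subseteq> \<Psi> {P < 1}\<close> (\<open>monotone_along_family\<close>).

  No equivariant map is monotone in this sense. Choose two coordinates \<open>i \<noteq> j\<close> and compare
  \<open>Q = \<bar>x\<bar>\<^sup>4 + \<bar>x\<^sub>i\<bar>\<^sup>4 + \<bar>x\<^sub>j\<bar>\<^sup>4\<close> with squares of hermitian forms
  \<open>G = a \<bar>\<langle>x, u\<rangle>\<bar>\<^sup>2 + b (\<bar>x\<bar>\<^sup>2 - \<bar>\<langle>x, u\<rangle>\<bar>\<^sup>2)\<close>, \<open>u\<close> a unit vector. Write \<open>\<Psi>(ball) = {h < 1}\<close> and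
  \<open>\<Psi> {Q < 1} = {h\<^sub>Q < 1}\<close> with hermitian forms \<open>h\<close>, \<open>h\<^sub>Q\<close>. Equivariance gives the form that belongs to
  \<open>{G\<^sup>2 < 1}\<close>, and its value at \<open>u\<close> is \<open>a h(u)\<close>. Now \<open>Q = 2\<close> at the unit vector \<open>e\<^sub>i\<close>, and \<open>Q - G\<^sup>2\<close> is an
  admissible \<open>R\<close> for \<open>u = e\<^sub>i\<close>, \<open>a = 7/5 < \<surd>2\<close>, \<open>b = 5/7\<close>; so \<open>h\<^sub>Q(e\<^sub>i) \<ge> 7/5 h(e\<^sub>i)\<close>, and likewise for
  \<open>j\<close>. But \<open>Q = 3/2\<close> at the unit vectors \<open>u = (e\<^sub>i \<plusminus> e\<^sub>j)/\<surd>2\<close>, and \<open>G\<^sup>2 - Q\<close> is admissible for these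
  with \<open>a = 4/3 > \<surd>(3/2)\<close>, \<open>b = 2\<close>; so \<open>h\<^sub>Q(u) \<le> 4/3 h(u)\<close>. Adding up, the parallelogram law for \<open>h\<close> and
  \<open>h\<^sub>Q\<close> gives \<open>7/5 (h(e\<^sub>i) + h(e\<^sub>j)) \<le> 4/3 (h(e\<^sub>i) + h(e\<^sub>j))\<close>, which is absurd.\<close>

section \<open>Coordinates on the product of a disc and \<open>\<complex>\<^sup>n\<close>\<close>

text \<open>The points of the base are elements of the coordinate space with the single index \<open>0\<close>, so that the
  identity is a chart.\<close>

definition disc_point :: "complex \<Rightarrow> nat \<Rightarrow> complex" where
  "disc_point w = (\<lambda>i\<in>{0}. w)"

text \<open>Identifying \<open>\<complex> \<times> \<complex>\<^sup>n\<close> with the product that carries the families allows topology and compactness to be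
  treated in an ordinary normed space.\<close>

definition lift :: "complex \<times> (complex^'n) \<Rightarrow> (nat \<Rightarrow> complex) \<times> (complex^'n)" where
  "lift = (\<lambda>(w, x). (disc_point w, x))"

definition unlift :: "(nat \<Rightarrow> complex) \<times> (complex^'n) \<Rightarrow> complex \<times> (complex^'n)" where
  "unlift = (\<lambda>(s, x). (s 0, x))"

text \<open>The chart of \<open>times_Cn\<close> over a disc with its tautological chart.\<close>

definition coordinates :: "(nat \<Rightarrow> complex) \<times> (complex^'n) \<Rightarrow> nat + 'n \<Rightarrow> complex" where
  "coordinates = (\<lambda>(s, x). case_sum s (\<lambda>j. x $ j))"

definition from_coordinates :: "(nat + 'n \<Rightarrow> complex) \<Rightarrow> complex \<times> (complex^'n)" where
  "from_coordinates z = (z (Inl 0), \<chi> j. z (Inr j))"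

abbreviation ambient :: "((nat \<Rightarrow> complex) \<times> (complex^'n)) topology" where
  "ambient \<equiv> prod_topology (coord_space {0}) euclidean"

lemma disc_point_0 [simp]: "disc_point w 0 = w"
  by (simp add: disc_point_def)

lemma disc_point_in: "disc_point w \<in> PiE {0} (\<lambda>_. UNIV)"
  by (simp add: disc_point_def)

lemma disc_point_eq: "s \<in> PiE {0::nat} (\<lambda>_. UNIV) \<Longrightarrow> disc_point (s 0) = s"
  by (auto simp: disc_point_def PiE_def extensional_def fun_eq_iff)

lemma unlift_lift [simp]: "unlift (lift p) = p"
  by (cases p) (simp add: lift_def unlift_def)

lemma lift_unlift: "p \<in> topspace ambient \<Longrightarrow> lift (unlift p) = p"
  by (cases p) (simp add: lift_def unlift_def disc_point_eq)

lemma from_coordinates_coordinates [simp]: "from_coordinates (coordinates (lift p)) = p"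
  by (cases p) (simp add: lift_def coordinates_def from_coordinates_def)

lemma coordinates_from_coordinates:
  "z \<in> topspace (coord_space ({0} <+> (UNIV :: 'n::finite set))) \<Longrightarrow> coordinates (lift (from_coordinates z)) = z"
proof (rule ext)
  fix i assume z: "z \<in> topspace (coord_space ({0} <+> (UNIV :: 'n set)))"
  have "z (Inl k) = undefined" if "k \<noteq> 0" for k
  proof -
    have "Inl k \<notin> {0} <+> (UNIV :: 'n set)" using that by auto
    with z show ?thesis by (auto simp: PiE_def extensional_def)
  qed
  then show "coordinates (lift (from_coordinates z)) i = z i"
    by (cases i) (auto simp: lift_def coordinates_def from_coordinates_def disc_point_def)
qed

lemma continuous_disc_point: "continuous_map euclidean (coord_space {0}) disc_point"
  by (auto simp: continuous_map_componentwise disc_point_def)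

lemma lift_homeomorphic: "homeomorphic_maps euclidean ambient lift unlift"
  unfolding homeomorphic_maps_def
proof (intro conjI ballI)
  show "continuous_map euclidean ambient (lift :: complex \<times> (complex^'n) \<Rightarrow> _)"
    unfolding continuous_map_pairwise
  proof
    have "continuous_map (euclidean::(complex \<times> (complex^'n)) topology) (coord_space {0}) (disc_point \<circ> fst)"
      by (rule continuous_map_compose[OF _ continuous_disc_point]) (simp add: continuous_on_fst)
    then show "continuous_map (euclidean::(complex \<times> (complex^'n)) topology) (coord_space {0}) (fst \<circ> lift)"
      by (simp add: o_def lift_def case_prod_unfold)
    show "continuous_map (euclidean::(complex \<times> (complex^'n)) topology) euclidean (snd \<circ> lift)"
      by (simp add: o_def lift_def case_prod_unfold continuous_on_snd)
  qed
  have "continuous_map ambient (prod_topology euclidean euclidean) (unlift :: _ \<Rightarrow> complex \<times> (complex^'n))"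
    unfolding continuous_map_pairwise
  proof
    have "continuous_map (ambient::(_ \<times> (complex^'n)) topology) euclidean ((\<lambda>s. s 0) \<circ> fst)"
      by (rule continuous_map_compose[OF continuous_map_fst continuous_map_product_projection]) simp
    then show "continuous_map (ambient::(_ \<times> (complex^'n)) topology) euclidean (fst \<circ> unlift)"
      by (simp add: o_def unlift_def case_prod_unfold)
    show "continuous_map (ambient::(_ \<times> (complex^'n)) topology) euclidean (snd \<circ> unlift)"
      using continuous_map_snd by (simp add: o_def unlift_def case_prod_unfold)
  qed
  then show "continuous_map ambient euclidean (unlift :: _ \<Rightarrow> complex \<times> (complex^'n))"
    by simp
qed (use lift_unlift in auto)

lemma coordinates_homeomorphic:
  "homeomorphic_maps euclidean (coord_space ({0} <+> (UNIV :: 'n::finite set)))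
     (\<lambda>p. coordinates (lift p)) from_coordinates"
  unfolding homeomorphic_maps_def
proof (intro conjI ballI)
  show "continuous_map euclidean (coord_space ({0} <+> UNIV)) (\<lambda>p. coordinates (lift (p :: complex \<times> (complex^'n))))"
    unfolding continuous_map_componentwise
  proof (intro conjI ballI)
    show "(\<lambda>p. coordinates (lift (p :: complex \<times> (complex^'n)))) ` topspace euclidean \<subseteq> extensional ({0} <+> UNIV)"
      by (auto simp: extensional_def coordinates_def lift_def disc_point_def split: sum.split)
    fix k :: "nat + 'n" assume "k \<in> {0} <+> UNIV"
    then show "continuous_map euclidean euclidean (\<lambda>p. coordinates (lift (p :: complex \<times> (complex^'n))) k)"
      by (auto simp: coordinates_def lift_def case_prod_unfold intro!: continuous_intros)
  qed
  let ?C = "coord_space ({0::nat} <+> (UNIV :: 'n set))"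
  have 1: "continuous_map ?C euclidean (\<lambda>z. z k)" if "k \<in> {0} <+> UNIV" for k
    using that by (rule continuous_map_product_projection)
  have "continuous_map ?C euclidean (\<lambda>z. \<Sum>j\<in>UNIV. z (Inr j) *s axis j (1::complex))"
  proof (rule continuous_map_sum)
    fix j :: 'n
    have "continuous_map ?C euclidean ((\<lambda>c. c *s axis j (1::complex)) \<circ> (\<lambda>z. z (Inr j)))"
      by (rule continuous_map_compose[OF 1])
         (auto simp: vector_scalar_mult_def continuous_map_iff_continuous2 intro!: continuous_intros)
    then show "continuous_map ?C euclidean (\<lambda>z. z (Inr j) *s axis j (1::complex))" by (simp add: o_def)
  qed simp
  moreover have "(\<Sum>j\<in>UNIV. z (Inr j) *s axis j (1::complex)) = (\<chi> j. z (Inr j))" for z :: "nat + 'n \<Rightarrow> complex"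
    using basis_expansion[of "\<chi> j. z (Inr j)"] by simp
  ultimately have 2: "continuous_map ?C euclidean (\<lambda>z. \<chi> j. z (Inr j))"
    by (simp only:)
  have "continuous_map ?C (prod_topology euclidean euclidean) from_coordinates"
    unfolding continuous_map_pairwise using 1[OF InlI, of 0] 2
    by (simp add: o_def from_coordinates_def)
  then show "continuous_map ?C euclidean (from_coordinates :: _ \<Rightarrow> complex \<times> (complex^'n))"
    by simp
qed (use coordinates_from_coordinates in auto)


definition base_disc :: "real \<Rightarrow> (nat \<Rightarrow> complex, nat) charted_space" where
  "base_disc \<rho> = \<lparr>points = subtopology (coord_space {0}) (disc_point ` ball 0 \<rho>), coords = {0},
     charts = {(disc_point ` ball 0 \<rho>, \<lambda>s. s)}\<rparr>"

definition domain_over_disc ::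
  "(complex \<times> (complex^'n)) set \<Rightarrow> ((nat \<Rightarrow> complex) \<times> (complex^'n), nat + 'n) charted_space" where
  "domain_over_disc W = \<lparr>points = subtopology ambient (lift ` W), coords = {0} <+> UNIV,
     charts = {(lift ` W, coordinates)}\<rparr>"

lemma topspace_base_disc [simp]: "topspace (points (base_disc \<rho>)) = disc_point ` ball 0 \<rho>"
  using disc_point_in by (auto simp: base_disc_def)

lemma lift_image_times: "lift ` (A \<times> B) = (disc_point ` A) \<times> B"
  by (auto simp: lift_def image_iff)

lemma prod_topology_base_disc:
  "prod_topology (points (base_disc \<rho>)) euclidean = subtopology ambient (lift ` (ball 0 \<rho> \<times> UNIV))"
  by (simp add: base_disc_def prod_topology_subtopology lift_image_times)

lemma open_submanifold_times_Cn_base_disc: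
  assumes "W \<subseteq> ball 0 \<rho> \<times> UNIV"
  shows "open_submanifold (times_Cn (base_disc \<rho>)) (lift ` W) = domain_over_disc W"
proof -
  have "lift ` W \<subseteq> (disc_point ` ball 0 \<rho>) \<times> UNIV"
    using assms by (auto simp: lift_def)
  then have "(disc_point ` ball 0 \<rho>) \<times> UNIV \<inter> lift ` W = lift ` W" by blast
  then show ?thesis
    by (simp add: open_submanifold_def domain_over_disc_def times_Cn_def prod_topology_base_disc
        subtopology_subtopology lift_image_times Int_absorb1)
       (simp add: base_disc_def coordinates_def)
qed

lemma openin_ambient_lift: "openin ambient (lift ` W) \<longleftrightarrow> open (W :: (complex \<times> (complex^'n)) set)"
  using homeomorphic_map_openness[of euclidean ambient lift W] lift_homeomorphic
  by (auto simp: homeomorphic_maps_map)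

lemma lift_in_ambient [simp]: "lift p \<in> topspace ambient"
  using disc_point_in by (cases p) (auto simp: lift_def)

lemma lift_image_ambient: "topspace ambient \<inter> lift ` W = lift ` W"
  by (rule Int_absorb1, rule image_subsetI, rule lift_in_ambient)

lemma openin_base_disc:
  "openin (prod_topology (points (base_disc \<rho>)) euclidean) X \<longleftrightarrow>
     (\<exists>W. X = lift ` W \<and> open W \<and> W \<subseteq> ball 0 \<rho> \<times> UNIV)"
proof -
  have op: "openin ambient (lift ` (ball 0 \<rho> \<times> (UNIV :: (complex^'a) set)))"
    by (simp add: openin_ambient_lift open_Times)
  have "openin (prod_topology (points (base_disc \<rho>)) euclidean) X \<longleftrightarrow>
      openin ambient X \<and> X \<subseteq> lift ` (ball 0 \<rho> \<times> UNIV)"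
    unfolding prod_topology_base_disc using op by (simp add: openin_open_subtopology)
  also have "\<dots> \<longleftrightarrow> (\<exists>W. X = lift ` W \<and> open W \<and> W \<subseteq> ball 0 \<rho> \<times> UNIV)"
    using openin_ambient_lift by (auto simp: subset_image_iff)
  finally show ?thesis .
qed

lemma inj_lift: "inj lift"
  by (metis injI unlift_lift)

lemma lift_homeomorphic_sub:
  "homeomorphic_map (subtopology euclidean W) (subtopology ambient (lift ` W)) lift"
proof -
  have "lift ` (topspace euclidean \<inter> W) = topspace ambient \<inter> lift ` W"
    by (simp only: lift_image_ambient topspace_euclidean Int_UNIV_left)
  from homeomorphic_maps_subtopologies[OF lift_homeomorphic this] show ?thesis
    by (simp only: homeomorphic_maps_map)
qed

lemma coordinates_homeomorphic_sub:
  "homeomorphic_map (subtopology ambient (lift ` W))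
     (subtopology (coord_space ({0} <+> UNIV)) (coordinates ` lift ` (W :: (complex \<times> (complex^'n)) set))) coordinates"
proof -
  have h1: "homeomorphic_maps ambient euclidean unlift (lift :: (complex \<times> (complex^'n)) \<Rightarrow> _)"
    using lift_homeomorphic homeomorphic_maps_sym by blast
  have h: "homeomorphic_maps ambient (coord_space ({0} <+> UNIV)) ((\<lambda>p. coordinates (lift p)) \<circ> unlift)
      (lift \<circ> (from_coordinates :: _ \<Rightarrow> complex \<times> (complex^'n)))"
    by (rule homeomorphic_maps_compose[OF conjI[OF h1 coordinates_homeomorphic]])
  have h2: "homeomorphic_maps ambient (coord_space ({0} <+> UNIV)) coordinates
      (lift \<circ> (from_coordinates :: _ \<Rightarrow> complex \<times> (complex^'n)))"
    by (rule homeomorphic_maps_eq[OF h]) (simp_all add: lift_unlift del: topspace_prod_topology)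
  then have "homeomorphic_map ambient (coord_space ({0} <+> (UNIV :: 'n set))) coordinates"
    by (auto simp: homeomorphic_maps_map)
  moreover have "coordinates ` (topspace ambient \<inter> lift ` W) = topspace (coord_space ({0} <+> (UNIV :: 'n set))) \<inter> coordinates ` lift ` W"
  proof -
    have "coordinates ` lift ` W \<subseteq> topspace (coord_space ({0} <+> (UNIV :: 'n set)))"
      using homeomorphic_imp_surjective_map[OF \<open>homeomorphic_map ambient _ coordinates\<close>] lift_in_ambient by blast
    then show ?thesis by (simp only: lift_image_ambient Int_absorb1)
  qed
  ultimately show ?thesis
    by (rule homeomorphic_map_subtopologies)
qed

lemma coordinates_open:
  fixes W :: "(complex \<times> (complex^'n)) set"
  shows "openin (coord_space ({0} <+> UNIV)) (coordinates ` lift ` W) \<longleftrightarrow> open W"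
proof -
  have "homeomorphic_map euclidean (coord_space ({0} <+> (UNIV :: 'n set))) (\<lambda>p. coordinates (lift p))"
    using coordinates_homeomorphic[where 'n='n] unfolding homeomorphic_maps_map by blast
  then have "openin (coord_space ({0} <+> UNIV)) ((\<lambda>p. coordinates (lift p)) ` W) \<longleftrightarrow> openin euclidean W"
    by (rule homeomorphic_map_openness) simp
  then show ?thesis by (simp only: image_image open_openin)
qed

lemma inj_on_coordinates: "inj_on coordinates (lift ` W)"
  by (rule inj_on_imageI, rule inj_on_inverseI[where g = from_coordinates]) simp

lemma inv_into_coordinates:
  "p \<in> W \<Longrightarrow> inv_into (lift ` W) coordinates (coordinates (lift p)) = lift p"
  by (rule inv_into_f_f[OF inj_on_coordinates]) (rule imageI)

lemma topspace_domain_over_disc: "topspace (points (domain_over_disc W)) = lift ` W"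
  unfolding domain_over_disc_def by (simp only: topspace_subtopology lift_image_ambient charted_space.simps)

lemma compactin_domain_over_disc:
  "K \<subseteq> W \<Longrightarrow> compactin (points (domain_over_disc W)) (lift ` K) \<longleftrightarrow> compact K"
  using homeomorphic_map_compactness[OF lift_homeomorphic_sub, of K W]
  by (simp add: domain_over_disc_def compactin_subtopology)

lemma second_countable_top_of_set:
  "second_countable (top_of_set (S :: 'a::second_countable_topology set))"
proof (rule second_countable_subtopology)
  obtain B :: "'a set set" where "countable B" "\<And>C. C \<in> B \<Longrightarrow> open C"
    "\<And>S. open S \<Longrightarrow> \<exists>U. U \<subseteq> B \<and> S = \<Union>U"
    using univ_second_countable by metis
  then show "second_countable (euclidean :: 'a topology)"
    unfolding second_countable_def by (intro exI[of _ B]) (simp, blast)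
qed

section \<open>Holomorphic functions over a disc\<close>

definition update_coord :: "complex^'n \<Rightarrow> 'n \<Rightarrow> complex \<Rightarrow> complex^'n" where
  "update_coord x j v = (\<chi> k. if k = j then v else x $ k)"

lemma update_coord_same [simp]: "update_coord x j (x $ j) = x"
  by (simp add: update_coord_def vec_eq_iff)

lemma update_coord_line: "update_coord x j v = (x - (x $ j) *s axis j 1) + v *s axis j 1"
  by (simp add: update_coord_def vec_eq_iff axis_def)

lemma continuous_update_coord: "continuous_on A (update_coord x j)"
  unfolding update_coord_def
  by (rule continuous_on_vec_lambda, rename_tac k, case_tac "k = j") (auto intro!: continuous_intros)

lemma coordinates_fun_upd:
  "(coordinates (lift (w, x)))(Inl 0 := v) = coordinates (lift (v, x))"
  "(coordinates (lift (w, x)))(Inr j := v) = coordinates (lift (w, update_coord x j v))"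
  by (auto simp: fun_eq_iff coordinates_def lift_def disc_point_def update_coord_def split: sum.split)

text \<open>Holomorphy in the coordinates of \<open>\<complex> \<times> \<complex>\<^sup>n\<close>: continuous, and holomorphic in each variable separately.\<close>

definition holomorphic_in_coords :: "(complex \<times> (complex^'n)) set \<Rightarrow> (complex \<times> (complex^'n) \<Rightarrow> complex) \<Rightarrow> bool" where
  "holomorphic_in_coords W F \<longleftrightarrow> continuous_on W F \<and>
     (\<forall>(w, x)\<in>W. (\<lambda>v. F (v, x)) field_differentiable at w \<and>
        (\<forall>j. (\<lambda>v. F (w, update_coord x j v)) field_differentiable at (x $ j)))"

text \<open>Complex differentiability only sees values near the point. This matters below because the
  inverse of a chart takes arbitrary values outside the image of the chart.\<close>

lemma field_differentiable_cong_open: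
  assumes "open S" "a \<in> S" "\<And>v. v \<in> S \<Longrightarrow> f v = g v"
  shows "f field_differentiable at a \<longleftrightarrow> g field_differentiable at a"
  using assms unfolding field_differentiable_def
  by (metis has_field_derivative_transform_within_open)

text \<open>Composed with \<open>lift\<close>, the chart is a homeomorphism, so continuity transfers; and since \<open>W\<close> is
  open, moving one coordinate slightly stays in the image of the chart, where its inverse is \<open>lift\<close>.\<close>

lemma holo_on_coord_coordinates:
  fixes W :: "(complex \<times> (complex^'n)) set"
  assumes W: "open W"
  shows "holo_on_coord ({0} <+> UNIV) (\<lambda>z. f (inv_into (lift ` W) coordinates z)) (coordinates ` lift ` W)
    \<longleftrightarrow> holomorphic_in_coords W (\<lambda>p. f (lift p))"
proof -
  let ?C = "coord_space ({0::nat} <+> (UNIV :: 'n set))"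
  let ?V = "coordinates ` lift ` W"
  let ?g = "\<lambda>z. f (inv_into (lift ` W) coordinates z)"
  have hom: "homeomorphic_maps (top_of_set W) (subtopology ?C ?V) (\<lambda>p. coordinates (lift p)) from_coordinates"
  proof (rule homeomorphic_maps_subtopologies_alt[OF coordinates_homeomorphic])
  qed (auto simp: image_iff)
  have g: "?g (coordinates (lift p)) = f (lift p)" if "p \<in> W" for p
    using that by (simp add: inv_into_coordinates)
  have cont: "continuous_map (subtopology ?C ?V) euclidean ?g \<longleftrightarrow> continuous_on W (\<lambda>p. f (lift p))"
  proof
    assume "continuous_map (subtopology ?C ?V) euclidean ?g"
    with hom have "continuous_map (top_of_set W) euclidean (?g \<circ> (\<lambda>p. coordinates (lift p)))"
      unfolding homeomorphic_maps_def by (metis continuous_map_compose)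
    then have "continuous_on W (?g \<circ> (\<lambda>p. coordinates (lift p)))" by simp
    then show "continuous_on W (\<lambda>p. f (lift p))"
      by (rule continuous_on_eq) (simp only: o_apply g)
  next
    assume "continuous_on W (\<lambda>p. f (lift p))"
    then have "continuous_map (top_of_set W) euclidean (\<lambda>p. f (lift p))" by simp
    with hom have "continuous_map (subtopology ?C ?V) euclidean ((\<lambda>p. f (lift p)) \<circ> from_coordinates)"
      unfolding homeomorphic_maps_def by (metis continuous_map_compose)
    then show "continuous_map (subtopology ?C ?V) euclidean ?g"
      by (rule continuous_map_eq) (auto simp: g)
  qed
  have diff0: "(\<lambda>v. ?g ((coordinates (lift (w, x)))(Inl 0 := v))) field_differentiable at w \<longleftrightarrow>
      (\<lambda>v. f (lift (v, x))) field_differentiable at w" if "(w, x) \<in> W" for w x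
  proof (rule field_differentiable_cong_open)
    have "open ((\<lambda>v. (v, x)) -` W)"
      by (rule open_vimage[OF W]) (intro continuous_on_Pair continuous_on_id continuous_on_const)
    then show "open {v. (v, x) \<in> W}" by (simp add: vimage_def)
  qed (use that in \<open>simp_all add: coordinates_fun_upd g\<close>)
  have diffj: "(\<lambda>v. ?g ((coordinates (lift (w, x)))(Inr j := v))) field_differentiable at (x $ j) \<longleftrightarrow>
      (\<lambda>v. f (lift (w, update_coord x j v))) field_differentiable at (x $ j)" if "(w, x) \<in> W" for w x j
  proof (rule field_differentiable_cong_open)
    have "open ((\<lambda>v. (w, update_coord x j v)) -` W)"
      by (rule open_vimage[OF W])
         (intro continuous_on_Pair continuous_on_const continuous_update_coord)
    then show "open {v. (w, update_coord x j v) \<in> W}" by (simp add: vimage_def)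
  qed (use that in \<open>simp_all add: coordinates_fun_upd g\<close>)
  have "(\<forall>z\<in>?V. \<forall>i\<in>{0} <+> UNIV. (\<lambda>w. ?g (z(i := w))) field_differentiable at (z i)) \<longleftrightarrow>
    (\<forall>(w, x)\<in>W. (\<lambda>v. ?g ((coordinates (lift (w, x)))(Inl 0 := v))) field_differentiable at w \<and>
     (\<forall>j. (\<lambda>v. ?g ((coordinates (lift (w, x)))(Inr j := v))) field_differentiable at (x $ j)))"
  proof -
    have c: "coordinates (lift p) (Inl 0) = fst p" "coordinates (lift p) (Inr j) = snd p $ j"
      for p :: "complex \<times> (complex^'n)" and j :: 'n
      by (auto simp: coordinates_def lift_def case_prod_beta)
    show ?thesis
      unfolding Plus_def by (simp add: ball_Un c case_prod_beta)
  qed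
  also have "\<dots> \<longleftrightarrow> (\<forall>(w, x)\<in>W. (\<lambda>v. f (lift (v, x))) field_differentiable at w \<and>
     (\<forall>j. (\<lambda>v. f (lift (w, update_coord x j v))) field_differentiable at (x $ j)))"
    by (intro ball_cong refl) (auto simp only: diff0 diffj)
  finally show ?thesis
    unfolding holo_on_coord_def holomorphic_in_coords_def cont by simp
qed

lemma holomorphic_in_coords_coordinates:
  assumes "i \<in> {0} <+> UNIV"
  shows "holomorphic_in_coords W (\<lambda>p. coordinates (lift p) i)"
proof (cases i)
  case (Inl k)
  then have "(\<lambda>p. coordinates (lift p) i) = fst"
    using assms by (auto simp: coordinates_def lift_def)
  then show ?thesis
    by (simp add: holomorphic_in_coords_def continuous_on_fst case_prod_beta
        field_differentiable_ident field_differentiable_const)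
next
  case (Inr j)
  then have "(\<lambda>p. coordinates (lift p) i) = (\<lambda>p. snd p $ j)"
    by (auto simp: coordinates_def lift_def)
  moreover have "(\<lambda>v. update_coord x k v $ j) field_differentiable F" for x :: "complex^'a" and k F
    by (cases "k = j") (simp_all add: update_coord_def field_differentiable_ident field_differentiable_const)
  moreover have "continuous_on W (\<lambda>p. snd p $ j)" by (intro continuous_intros)
  ultimately show ?thesis
    by (simp add: holomorphic_in_coords_def case_prod_beta field_differentiable_const)
qed

lemma complex_manifold_domain_over_disc:
  assumes "open W"
  shows "complex_manifold (domain_over_disc (W :: (complex \<times> (complex^'n)) set))"
  unfolding complex_manifold_def
proof (intro conjI)
  let ?M = "domain_over_disc W"
  have hs: "top_of_set W homeomorphic_space points ?M"
    using homeomorphic_map_imp_homeomorphic_space[OF lift_homeomorphic_sub[of W]]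
    by (simp add: domain_over_disc_def)
  show "finite (coords ?M)" by (simp add: domain_over_disc_def)
  show "Hausdorff_space (points ?M)"
    using homeomorphic_Hausdorff_space[OF hs] by (simp add: Hausdorff_space_subtopology)
  show "second_countable (points ?M)"
    using homeomorphic_space_second_countability[OF hs] second_countable_top_of_set by blast
  have V: "openin (coord_space ({0} <+> (UNIV :: 'n set))) (coordinates ` lift ` W)"
    using assms coordinates_open by blast
  have "topological_chart ?M (lift ` W) coordinates"
    unfolding topological_chart_def
  proof (intro conjI)
    show "openin (points ?M) (lift ` W)" by (metis openin_topspace topspace_domain_over_disc)
    show "openin (coord_space (coords ?M)) (coordinates ` lift ` W)"
      using V by (simp add: domain_over_disc_def)
    show "homeomorphic_map (subtopology (points ?M) (lift ` W)) 
     (subtopology (coord_space (coords ?M)) (coordinates ` lift ` W)) coordinates"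
      using coordinates_homeomorphic_sub[of W] by (simp add: domain_over_disc_def subtopology_subtopology)
  qed
  then show "\<forall>(U, \<phi>)\<in>charts ?M. topological_chart ?M U \<phi>"
    by (simp add: domain_over_disc_def)
  show "(\<Union>(U, \<phi>)\<in>charts ?M. U) = topspace (points ?M)"
    unfolding topspace_domain_over_disc by (simp add: domain_over_disc_def)
  have "holomorphic_transition ?M (lift ` W, coordinates) (lift ` W, coordinates)"
    unfolding holomorphic_transition_def
    using holo_on_coord_coordinates[OF assms, where f = "\<lambda>p. coordinates p i" for i]
      holomorphic_in_coords_coordinates[where W = W]
    by (simp add: domain_over_disc_def)
  then show "\<forall>c\<in>charts ?M. \<forall>d\<in>charts ?M. holomorphic_transition ?M c d"
    by (simp add: domain_over_disc_def)
qed

lemma holomorphic_fun_domain_over_disc: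
  "open W \<Longrightarrow> holomorphic_fun (domain_over_disc W) f \<longleftrightarrow> holomorphic_in_coords W (\<lambda>p. f (lift p))"
  using holo_on_coord_coordinates[of W f] by (simp add: holomorphic_fun_def domain_over_disc_def)

section \<open>Stein domains over a disc\<close>

lemma complex_manifold_base_disc: "complex_manifold (base_disc \<rho>)"
proof -
  let ?M = "base_disc \<rho>" and ?U = "disc_point ` ball 0 \<rho>"
  have U: "topspace (coord_space {0}) \<inter> ?U = ?U"
    by (rule Int_absorb1, rule image_subsetI) (simp add: disc_point_in)
  have hs: "homeomorphic_maps euclidean (coord_space {0}) disc_point (\<lambda>s. s (0::nat))"
    unfolding homeomorphic_maps_def
    by (intro conjI continuous_disc_point continuous_map_product_projection) (auto simp: disc_point_eq)
  have "homeomorphic_maps (top_of_set (ball 0 \<rho>)) (subtopology (coord_space {0}) ?U) disc_point (\<lambda>s. s 0)"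
    by (rule homeomorphic_maps_subtopologies[OF hs]) (simp only: U topspace_euclidean Int_UNIV_left)
  then have hom: "top_of_set (ball (0::complex) \<rho>) homeomorphic_space points ?M"
    unfolding base_disc_def charted_space.simps homeomorphic_space_def by blast
  have "openin (coord_space {0}) ?U"
    using homeomorphic_map_openness[of euclidean "coord_space {0}" disc_point "ball 0 \<rho>"] hs
    by (simp add: homeomorphic_maps_map)
  then have oU: "openin (coord_space {0}) ?U" "openin (points ?M) ?U"
    by (auto simp: base_disc_def openin_subtopology)
  have sc: "second_countable (points ?M)"
    using homeomorphic_space_second_countability[OF hom] second_countable_top_of_set by blast
  have hd: "Hausdorff_space (points ?M)"
    using homeomorphic_Hausdorff_space[OF hom] by (simp add: Hausdorff_space_subtopology)
  have inv: "inv_into ?U (\<lambda>s. s) z = z" if "z \<in> ?U" for z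
    using f_inv_into_f[of z "\<lambda>s. s" ?U] that by simp
  have "holo_on_coord {0} (\<lambda>z. inv_into ?U (\<lambda>s. s) z 0) ?U"
    unfolding holo_on_coord_def
  proof (intro conjI ballI)
    have "continuous_map (subtopology (coord_space {0}) ?U) euclidean (\<lambda>z. z (0::nat))"
      by (rule continuous_map_from_subtopology, rule continuous_map_product_projection) simp
    then show "continuous_map (subtopology (coord_space {0}) ?U) euclidean (\<lambda>z. inv_into ?U (\<lambda>s. s) z 0)"
      by (rule continuous_map_eq) (simp add: inv)
    fix z :: "nat \<Rightarrow> complex" and i :: nat assume z: "z \<in> ?U" and i: "i \<in> {0}"
    have upd: "z(0 := v) = disc_point v" for v
      using z by (auto simp: disc_point_def fun_eq_iff)
    have "(\<lambda>w. inv_into ?U (\<lambda>s. s) (z(0 := w)) 0) field_differentiable at (z 0) \<longleftrightarrow>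
        (\<lambda>w. w) field_differentiable at (z 0)"
    proof (rule field_differentiable_cong_open[of "ball 0 \<rho>"])
      show "z 0 \<in> ball 0 \<rho>" using z by auto
      fix v :: complex assume "v \<in> ball 0 \<rho>"
      then have "disc_point v \<in> ?U" by blast
      from inv[OF this] show "inv_into ?U (\<lambda>s. s) (z(0 := v)) 0 = v"
        unfolding upd by (simp only: disc_point_0)
    qed simp
    then show "(\<lambda>w. inv_into ?U (\<lambda>s. s) (z(i := w)) 0) field_differentiable at (z i)"
      using i by (simp add: field_differentiable_ident)
  qed
  then have tr: "holomorphic_transition ?M (?U, \<lambda>s. s) (?U, \<lambda>s. s)"
    by (simp add: holomorphic_transition_def base_disc_def)
  have "topological_chart ?M ?U (\<lambda>s. s)"
    unfolding topological_chart_def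
    using oU homeomorphic_map_id[of "subtopology (coord_space {0}) ?U" "subtopology (coord_space {0}) ?U"]
    by (simp add: base_disc_def subtopology_subtopology id_def)
  then show ?thesis
    unfolding complex_manifold_def using sc hd tr topspace_base_disc[of \<rho>]
    by (simp add: base_disc_def)
qed

text \<open>The coordinate functions are global holomorphic functions, so they separate points and form a chart
  of the maximal atlas. Only the hull remains; it is relatively closed, hence compact as soon as it lies
  in some compact subset of \<open>W\<close>.\<close>

lemma stein_domain_over_disc:
  fixes W :: "(complex \<times> (complex^'n)) set"
  assumes W: "open W"
    and hull: "\<And>K. compact K \<Longrightarrow> K \<subseteq> W \<Longrightarrow> \<exists>L. compact L \<and> L \<subseteq> W \<and>
      (\<forall>p\<in>W. (\<forall>F B. holomorphic_in_coords W F \<longrightarrow> (\<forall>k\<in>K. cmod (F k) \<le> B) \<longrightarrow> cmod (F p) \<le> B) \<longrightarrow> p \<in> L)"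
  shows "stein_manifold (domain_over_disc W)"
proof -
  let ?M = "domain_over_disc W"
  note hf = holomorphic_fun_domain_over_disc[OF W]
  note top = topspace_domain_over_disc[of W] and cpt = compactin_domain_over_disc[of _ W]
  have hol_coord: "holomorphic_fun ?M (\<lambda>y. coordinates y i)" if "i \<in> {0} <+> UNIV" for i
    using that by (simp add: hf holomorphic_in_coords_coordinates)
  have hullc: "compactin (points ?M) (holomorphic_hull ?M K')" if K': "compactin (points ?M) K'" for K'
  proof -
    from compactin_subset_topspace[OF K'] obtain K where K: "K \<subseteq> W" "K' = lift ` K"
      unfolding top by (meson subset_image_iff)
    with K' cpt have "compact K" by blast
    from hull[OF this K(1)] obtain L where L: "compact L" "L \<subseteq> W" 
      and LH: "\<And>p. p \<in> W \<Longrightarrow> (\<And>F B. holomorphic_in_coords W F \<Longrightarrow> (\<forall>k\<in>K. cmod (F k) \<le> B) \<Longrightarrow> cmod (F p) \<le> B) \<Longrightarrow> p \<in> L"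
      by blast
    define I where "I = {(f, B). holomorphic_fun ?M f \<and> (\<forall>k\<in>K. cmod (f (lift k)) \<le> B)}"
    define H where "H = L \<inter> (\<Inter>(f, B)\<in>I. {p\<in>W. cmod (f (lift p)) \<le> B})"
    have cl: "closedin (top_of_set W) {p\<in>W. cmod (f (lift p)) \<le> B}" if "(f, B) \<in> I" for f B
    proof -
      have "continuous_on W (\<lambda>p. cmod (f (lift p)))"
        using that by (intro continuous_on_norm) (simp add: I_def hf holomorphic_in_coords_def)
      from continuous_closedin_preimage[OF this, of "{..B}"] show ?thesis
        by (simp add: vimage_def Collect_conj_eq)
    qed
    have "(\<lambda>_. 0, 0) \<in> I"
      by (simp add: I_def hf holomorphic_in_coords_def field_differentiable_const case_prod_beta)
    then have "I \<noteq> {}" by blast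
    then have "closedin (top_of_set W) (\<Inter>(f, B)\<in>I. {p\<in>W. cmod (f (lift p)) \<le> B})"
      using cl by (intro closedin_INT) auto
    then obtain C where C: "closed C" "(\<Inter>(f, B)\<in>I. {p\<in>W. cmod (f (lift p)) \<le> B}) = W \<inter> C"
      by (auto simp: closedin_closed)
    have "H = L \<inter> C" unfolding H_def C(2) using L(2) by blast
    then have "compact H" using L(1) C(1) by (simp add: compact_Int_closed)
    moreover have "H \<subseteq> W" using L(2) by (auto simp: H_def)
    moreover have "holomorphic_hull ?M K' = lift ` H"
    proof
      show "lift ` H \<subseteq> holomorphic_hull ?M K'"
      proof (rule image_subsetI)
        fix p assume p: "p \<in> H"
        have "cmod (f (lift p)) \<le> B" if "holomorphic_fun ?M f" "\<forall>k\<in>K'. cmod (f k) \<le> B" for f B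
        proof -
          have "(f, B) \<in> I" using that K(2) by (simp add: I_def)
          then show ?thesis using p by (auto simp: H_def)
        qed
        then show "lift p \<in> holomorphic_hull ?M K'"
          unfolding holomorphic_hull_def top using p \<open>H \<subseteq> W\<close> by blast
      qed
      show "holomorphic_hull ?M K' \<subseteq> lift ` H"
      proof
        fix y assume y: "y \<in> holomorphic_hull ?M K'"
        then obtain p where p: "p \<in> W" "y = lift p" unfolding holomorphic_hull_def top by blast
        have b: "cmod (f (lift p)) \<le> B" if "holomorphic_fun ?M f" "\<forall>k\<in>K. cmod (f (lift k)) \<le> B" for f B
          using y that K(2) unfolding holomorphic_hull_def p(2) by blast
        have "p \<in> L"
        proof (rule LH[OF p(1)])
          fix F B assume "holomorphic_in_coords W F" "\<forall>k\<in>K. cmod (F k) \<le> B"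
          then show "cmod (F p) \<le> B"
            using b[of "\<lambda>y. F (unlift y)" B] by (simp add: hf)
        qed
        moreover have "p \<in> (\<Inter>(f, B)\<in>I. {p\<in>W. cmod (f (lift p)) \<le> B})"
          using b p(1) by (auto simp: I_def)
        ultimately show "y \<in> lift ` H" unfolding H_def p(2) by blast
      qed
    qed
    ultimately show ?thesis using cpt by simp
  qed
  have sep: "\<exists>f. holomorphic_fun ?M f \<and> f x \<noteq> f y"
    if xy: "x \<in> topspace (points ?M)" "y \<in> topspace (points ?M)" "x \<noteq> y" for x y
  proof -
    from xy obtain p q where pq: "x = lift p" "y = lift q" unfolding top by blast
    with xy(3) have "coordinates x \<noteq> coordinates y" by (metis from_coordinates_coordinates)
    then obtain i where i: "coordinates x i \<noteq> coordinates y i" by blast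
    then have "i \<in> {0} <+> UNIV"
      by (cases i) (auto simp: pq coordinates_def lift_def disc_point_def case_prod_beta split: if_splits)
    then show ?thesis using hol_coord i by blast
  qed
  have loc: "\<exists>U F. x \<in> U \<and> (\<forall>i\<in>coords ?M. holomorphic_fun ?M (F i)) \<and>
        holomorphic_chart ?M U (\<lambda>y. \<lambda>i\<in>coords ?M. F i y)" if "x \<in> topspace (points ?M)" for x
  proof (intro exI conjI)
    show "x \<in> lift ` W" using that unfolding top .
    show "\<forall>i\<in>coords ?M. holomorphic_fun ?M ((\<lambda>i y. coordinates y i) i)"
      using hol_coord by (simp add: domain_over_disc_def)
    let ?\<phi> = "\<lambda>y. \<lambda>i\<in>coords ?M. coordinates y i"
    have eq: "?\<phi> y = coordinates y" if "y \<in> lift ` W" for y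
    proof
      fix i show "?\<phi> y i = coordinates y i"
        using that by (cases i) (auto simp: domain_over_disc_def coordinates_def lift_def disc_point_def split: if_splits)
    qed
    have eq_conj: "y \<in> lift ` W \<and> ?\<phi> y = z \<longleftrightarrow> y \<in> lift ` W \<and> coordinates y = z" for y z
      using eq[of y] by (cases "y \<in> lift ` W") (simp_all only: simp_thms)
    have inv: "inv_into (lift ` W) ?\<phi> = inv_into (lift ` W) coordinates"
      by (rule ext) (simp only: inv_into_def eq_conj)
    have im: "?\<phi> ` A = coordinates ` A" if "A \<subseteq> lift ` W" for A
      by (rule image_cong[OF refl eq]) (rule subsetD[OF that])
    have cm: "complex_manifold ?M" by (rule complex_manifold_domain_over_disc[OF W])
    have ch: "charts ?M = {(lift ` W, coordinates)}" by (simp add: domain_over_disc_def)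
    have tc: "topological_chart ?M (lift ` W) coordinates"
      and tr: "holomorphic_transition ?M (lift ` W, coordinates) (lift ` W, coordinates)"
      using cm unfolding complex_manifold_def ch by auto
    have "topological_chart ?M (lift ` W) ?\<phi>"
      unfolding topological_chart_def im[OF order_refl]
    proof (intro conjI)
      show "openin (points ?M) (lift ` W)" "openin (coord_space (coords ?M)) (coordinates ` lift ` W)"
        using tc by (simp_all add: topological_chart_def)
      have "homeomorphic_map (subtopology (points ?M) (lift ` W))
          (subtopology (coord_space (coords ?M)) (coordinates ` lift ` W)) coordinates"
        using tc by (simp add: topological_chart_def)
      then show "homeomorphic_map (subtopology (points ?M) (lift ` W))
          (subtopology (coord_space (coords ?M)) (coordinates ` lift ` W)) ?\<phi>"
        by (rule homeomorphic_map_eq) (metis eq topspace_subtopology IntD2)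
    qed
    moreover have "holomorphic_transition ?M (lift ` W, coordinates) (lift ` W, ?\<phi>)"
    proof -
      have "holo_on_coord ({0} <+> UNIV) (\<lambda>z. ?\<phi> (inv_into (lift ` W) coordinates z) i) (coordinates ` lift ` W)"
        if "i \<in> {0} <+> UNIV" for i
        using that holomorphic_in_coords_coordinates[of i W]
          holo_on_coord_coordinates[OF W, where f = "\<lambda>y. coordinates y i"]
        by (simp add: domain_over_disc_def)
      then show ?thesis
        unfolding holomorphic_transition_def by (simp add: domain_over_disc_def)
    qed
    moreover have "holomorphic_transition ?M (lift ` W, ?\<phi>) (lift ` W, coordinates)"
      using tr unfolding holomorphic_transition_def by (simp only: prod.case inv Int_absorb im[OF order_refl])
    ultimately show "holomorphic_chart ?M (lift ` W) (\<lambda>y. \<lambda>i\<in>coords ?M. (\<lambda>i y. coordinates y i) i y)"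
      unfolding holomorphic_chart_def ch by simp
  qed
  show ?thesis
    unfolding stein_manifold_def
    by (intro conjI allI impI ballI)
       (erule hullc | erule (2) sep | erule loc | rule complex_manifold_domain_over_disc[OF W])+
qed

section \<open>The continuity principle\<close>

text \<open>By the maximum principle, a closed disc \<open>{(w, \<tau> x). \<bar>w\<bar> \<le> 1}\<close> contained in \<open>W\<close> lies in the holomorphic hull
  \<open>H\<close> of the union \<open>K\<close> of the boundary circles. As \<open>H\<close> is a compact subset of \<open>W\<close>, the set \<open>A\<close> of those
  \<open>\<tau>\<close> for which the disc lies in \<open>W\<close> is closed; it is open because \<open>W\<close> is open and discs are compact.
  It contains \<open>0\<close>, hence also \<open>1\<close>.\<close>

lemma continuity_principle:
  fixes W :: "(complex \<times> (complex^'n)) set" and x :: "complex^'n"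
  assumes W: "open W" and stein: "stein_manifold (domain_over_disc W)"
    and zero: "cball 0 1 \<times> {0} \<subseteq> W"
    and bd: "\<And>w \<tau>. cmod w = 1 \<Longrightarrow> 0 \<le> \<tau> \<Longrightarrow> \<tau> \<le> 1 \<Longrightarrow> (w, \<tau> *\<^sub>R x) \<in> W"
  shows "cball 0 1 \<times> {x} \<subseteq> W"
proof -
  let ?M = "domain_over_disc W"
  define K where "K = (\<lambda>(w, \<tau>). (w, \<tau> *\<^sub>R x)) ` (sphere (0::complex) 1 \<times> {0..1})"
  define A where "A = {\<tau>\<in>{0..1}. \<forall>w\<in>cball 0 1. (w, \<tau> *\<^sub>R x) \<in> W}"
  define H where "H = {p \<in> W. \<forall>F B. holomorphic_in_coords W F \<longrightarrow> (\<forall>k\<in>K. cmod (F k) \<le> B) \<longrightarrow> cmod (F p) \<le> B}"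
  note top = topspace_domain_over_disc[of W] and cpt = compactin_domain_over_disc[of _ W]
  have cont: "continuous_on S (\<lambda>(w, \<tau>). (w, \<tau> *\<^sub>R x))" for S :: "(complex \<times> real) set"
    by (simp add: case_prod_beta) (intro continuous_intros)
  have "compact K"
    unfolding K_def by (rule compact_continuous_image[OF cont]) (intro compact_Times compact_sphere compact_Icc)
  have "K \<subseteq> W" using bd by (auto simp: K_def)
  have "holomorphic_hull ?M (lift ` K) = lift ` H"
  proof
    show "lift ` H \<subseteq> holomorphic_hull ?M (lift ` K)"
      unfolding holomorphic_hull_def top by (auto simp: H_def holomorphic_fun_domain_over_disc[OF W])
    show "holomorphic_hull ?M (lift ` K) \<subseteq> lift ` H"
    proof
      fix y assume y: "y \<in> holomorphic_hull ?M (lift ` K)"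
      then obtain p where p: "p \<in> W" "y = lift p" unfolding holomorphic_hull_def top by blast
      have "cmod (F p) \<le> B" if "holomorphic_in_coords W F" "\<forall>k\<in>K. cmod (F k) \<le> B" for F B
      proof -
        have "holomorphic_fun ?M (\<lambda>y. F (unlift y))" 
          using that by (simp add: holomorphic_fun_domain_over_disc[OF W])
        moreover have "\<forall>k\<in>lift ` K. cmod (F (unlift k)) \<le> B" using that by simp
        ultimately have "cmod (F (unlift (lift p))) \<le> B"
          using y unfolding holomorphic_hull_def p(2) by blast
        then show ?thesis by simp
      qed
      then show "y \<in> lift ` H" unfolding p(2) H_def using p(1) by blast
    qed
  qed
  then have "compact H"
    using stein cpt[OF \<open>K \<subseteq> W\<close>] \<open>compact K\<close> cpt[of H] unfolding stein_manifold_def H_def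
    by (metis (no_types, lifting) mem_Collect_eq subsetI)
  have A_eq: "A = {0..1} \<inter> (\<Inter>w\<in>cball 0 1. (\<lambda>\<tau>. (w, \<tau> *\<^sub>R x)) -` H)"
  proof
    show "{0..1} \<inter> (\<Inter>w\<in>cball 0 1. (\<lambda>\<tau>. (w, \<tau> *\<^sub>R x)) -` H) \<subseteq> A"
      by (auto simp: A_def H_def)
    have "(w, \<tau> *\<^sub>R x) \<in> H" if tw: "\<tau> \<in> A" "w \<in> cball 0 1" for w \<tau>
    proof -
      have "cmod (F (w, \<tau> *\<^sub>R x)) \<le> B" if F: "holomorphic_in_coords W F" "\<forall>k\<in>K. cmod (F k) \<le> B" for F B
      proof (rule maximum_modulus_frontier[where S = "cball 0 1" and f = "\<lambda>w. F (w, \<tau> *\<^sub>R x)"])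
        have d: "(\<lambda>v. F (v, \<tau> *\<^sub>R x)) field_differentiable at v" if "v \<in> cball 0 1" for v
          using that tw(1) F(1) unfolding A_def holomorphic_in_coords_def by blast
        then show "(\<lambda>w. F (w, \<tau> *\<^sub>R x)) holomorphic_on interior (cball 0 1)"
          unfolding holomorphic_on_def by (meson field_differentiable_at_within interior_subset subsetD)
        show "continuous_on (closure (cball 0 1)) (\<lambda>w. F (w, \<tau> *\<^sub>R x))"
          using d by (simp add: continuous_at_imp_continuous_on field_differentiable_imp_continuous_at)
        show "cmod (F (z, \<tau> *\<^sub>R x)) \<le> B" if "z \<in> frontier (cball 0 1)" for z
        proof -
          have "(z, \<tau>) \<in> sphere 0 1 \<times> {0..1}" using that tw(1) by (simp add: A_def)
          then have "(z, \<tau> *\<^sub>R x) \<in> K" unfolding K_def by force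
          then show ?thesis using F(2) by blast
        qed
      qed (use tw in auto)
      then show ?thesis using tw by (auto simp: H_def A_def)
    qed
    then show "A \<subseteq> {0..1} \<inter> (\<Inter>w\<in>cball 0 1. (\<lambda>\<tau>. (w, \<tau> *\<^sub>R x)) -` H)"
      by (auto simp: A_def)
  qed
  have "closed A"
    unfolding A_eq using \<open>compact H\<close>
    by (intro closed_Int closed_INT ballI closed_vimage compact_imp_closed continuous_on_Pair
        continuous_on_const continuous_on_scaleR continuous_on_id) auto
  then have clo: "closedin (top_of_set {0..1}) A"
    by (intro closed_subset) (auto simp: A_def)
  have ope: "openin (top_of_set {0..1}) A"
  proof -
    let ?D = "(cball (0::complex) 1 \<times> {0..1::real}) \<inter> (\<lambda>(w, \<tau>). (w, \<tau> *\<^sub>R x)) -` (- W)"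
    have "compact ?D"
      using W by (intro compact_Int_closed compact_Times closed_vimage cont) auto
    then have "compact (snd ` ?D)" by (intro compact_continuous_image continuous_intros)
    then have "closed (snd ` ?D)" by (rule compact_imp_closed)
    moreover have "A = {0..1} \<inter> - (snd ` ?D)" 
    proof (rule set_eqI)
      fix \<tau> show "\<tau> \<in> A \<longleftrightarrow> \<tau> \<in> {0..1} \<inter> - (snd ` ?D)"
        by (simp add: A_def image_iff Bex_def split_paired_Ex del: mem_cball_0 mem_cball) blast
    qed
    ultimately show ?thesis unfolding openin_open by (intro exI[of _ "- (snd ` ?D)"] conjI open_Compl)
  qed
  have "0 \<in> A" using zero by (auto simp: A_def)
  have "connected {0..1::real}" by simp
  then have "A = {0..1}"
    using clo ope \<open>0 \<in> A\<close> unfolding connected_clopen by blast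
  then have "1 \<in> A" by simp
  then show ?thesis by (auto simp: A_def)
qed

section \<open>Envelopes of entire functions\<close>

text \<open>Holomorphy is required along every complex line. Coordinate lines give separate holomorphy,
  and arbitrary lines give the mean value property on affine discs.\<close>

definition entire :: "(complex^'n \<Rightarrow> complex) \<Rightarrow> bool" where
  "entire f \<longleftrightarrow> continuous_on UNIV f \<and> (\<forall>z w. (\<lambda>\<zeta>. f (z + \<zeta> *s w)) holomorphic_on UNIV)"

lemma entire_const [simp]: "entire (\<lambda>_. c)"
  by (simp add: entire_def)

lemma entire_component [simp]: "entire (\<lambda>x. x $ i)"
  by (auto simp: entire_def intro!: continuous_intros holomorphic_intros)

lemma entire_add: "entire f \<Longrightarrow> entire g \<Longrightarrow> entire (\<lambda>x. f x + g x)"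
  by (auto simp: entire_def intro!: continuous_on_add holomorphic_on_add)

lemma entire_diff: "entire f \<Longrightarrow> entire g \<Longrightarrow> entire (\<lambda>x. f x - g x)"
  by (auto simp: entire_def intro!: continuous_on_diff holomorphic_on_diff)

lemma entire_mult: "entire f \<Longrightarrow> entire g \<Longrightarrow> entire (\<lambda>x. f x * g x)"
  by (auto simp: entire_def intro!: continuous_on_mult holomorphic_on_mult)

lemma entire_sum: "(\<And>i. i \<in> I \<Longrightarrow> entire (f i)) \<Longrightarrow> entire (\<lambda>x. \<Sum>i\<in>I. f i x)"
  by (auto simp: entire_def intro!: continuous_on_sum holomorphic_on_sum)

lemma entire_matrix_vector: "entire (\<lambda>x. ((A :: complex^'n^'m) *v x) $ k)"
  unfolding matrix_vector_mult_def by (simp add: entire_sum entire_mult)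

text \<open>For \<open>P = \<Sum>\<^sub>i \<bar>f\<^sub>i\<bar>\<^sup>2\<close> the function \<open>f = \<Sum>\<^sub>i cnj (f\<^sub>i z) f\<^sub>i\<close> satisfies \<open>f z = P z\<close>, and
  \<open>\<bar>f\<bar>\<^sup>2 \<le> P z P\<close> by the Cauchy-Schwarz inequality. The definition keeps only this property: \<open>P\<close> is the
  largest of the functions \<open>\<bar>f\<bar>\<^sup>2 / P z\<close>, which makes \<open>log P\<close> plurisubharmonic, and no
  representation as a sum has to be carried through sums and products.\<close>

definition entire_envelope :: "(complex^'n \<Rightarrow> real) \<Rightarrow> bool" where
  "entire_envelope P \<longleftrightarrow> (\<forall>z. 0 \<le> P z \<and>
     (\<exists>f. entire f \<and> f z = of_real (P z) \<and> (\<forall>x. (cmod (f x))\<^sup>2 \<le> P z * P x)))"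

lemma entire_envelope_nonneg: "entire_envelope P \<Longrightarrow> 0 \<le> P z"
  by (simp add: entire_envelope_def)

lemma entire_envelopeE:
  assumes "entire_envelope P"
  obtains f where "entire f" "f z = of_real (P z)" "\<And>x. (cmod (f x))\<^sup>2 \<le> P z * P x"
  using assms unfolding entire_envelope_def by blast

text \<open>The Cauchy-Schwarz inequality in the plane for the vectors \<open>(\<surd>A, \<surd>B)\<close> and \<open>(\<surd>A', \<surd>B')\<close>.\<close>

lemma cauchy_schwarz_sum:
  fixes a b :: complex
  assumes a: "(cmod a)\<^sup>2 \<le> A * A'" and b: "(cmod b)\<^sup>2 \<le> B * B'"
    and nn: "0 \<le> A" "0 \<le> A'" "0 \<le> B" "0 \<le> B'"
  shows "(cmod (a + b))\<^sup>2 \<le> (A + B) * (A' + B')"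
proof -
  have "(2 * cmod a * cmod b)\<^sup>2 = 4 * ((cmod a)\<^sup>2 * (cmod b)\<^sup>2)" by (simp add: power_mult_distrib)
  also have "\<dots> \<le> 4 * ((A * A') * (B * B'))"
    using a b nn by (intro mult_left_mono mult_mono) auto
  also have "\<dots> = (A * B' + B * A')\<^sup>2 - (A * B' - B * A')\<^sup>2" by (simp add: power2_eq_square algebra_simps)
  also have "\<dots> \<le> (A * B' + B * A')\<^sup>2" by simp
  finally have "2 * cmod a * cmod b \<le> A * B' + B * A'"
    by (rule power2_le_imp_le) (use nn in auto)
  moreover have "(cmod (a + b))\<^sup>2 \<le> (cmod a + cmod b)\<^sup>2"
    by (intro power_mono norm_triangle_ineq) auto
  ultimately show ?thesis using a b by (simp add: power2_sum algebra_simps)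
qed

lemma entire_envelope_norm: "entire f \<Longrightarrow> entire_envelope (\<lambda>x. (cmod (f x))\<^sup>2)"
  unfolding entire_envelope_def
proof (intro allI conjI)
  fix z assume f: "entire f"
  show "\<exists>g. entire g \<and> g z = of_real ((cmod (f z))\<^sup>2) \<and> (\<forall>x. (cmod (g x))\<^sup>2 \<le> (cmod (f z))\<^sup>2 * (cmod (f x))\<^sup>2)"
    by (rule exI[of _ "\<lambda>x. cnj (f z) * f x"])
       (use complex_norm_square[of "f z"] in \<open>simp add: entire_mult f norm_mult power_mult_distrib mult.commute\<close>)
qed simp

lemma entire_envelope_add:
  assumes P: "entire_envelope P" and Q: "entire_envelope Q"
  shows "entire_envelope (\<lambda>x. P x + Q x)"
  unfolding entire_envelope_def
proof (intro allI conjI)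
  fix z
  show "0 \<le> P z + Q z" by (simp add: P Q entire_envelope_nonneg)
  obtain f where f: "entire f" "f z = of_real (P z)" "\<And>x. (cmod (f x))\<^sup>2 \<le> P z * P x"
    using entire_envelopeE[OF P] by metis
  obtain g where g: "entire g" "g z = of_real (Q z)" "\<And>x. (cmod (g x))\<^sup>2 \<le> Q z * Q x"
    using entire_envelopeE[OF Q] by metis
  show "\<exists>h. entire h \<and> h z = of_real (P z + Q z) \<and> (\<forall>x. (cmod (h x))\<^sup>2 \<le> (P z + Q z) * (P x + Q x))"
    by (rule exI[of _ "\<lambda>x. f x + g x"])
       (auto simp: entire_add f g P Q entire_envelope_nonneg intro!: cauchy_schwarz_sum)
qed

lemma entire_envelope_mult:
  assumes P: "entire_envelope P" and Q: "entire_envelope Q"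
  shows "entire_envelope (\<lambda>x. P x * Q x)"
  unfolding entire_envelope_def
proof (intro allI conjI)
  fix z
  show "0 \<le> P z * Q z" by (simp add: P Q entire_envelope_nonneg)
  obtain f where f: "entire f" "f z = of_real (P z)" "\<And>x. (cmod (f x))\<^sup>2 \<le> P z * P x"
    using entire_envelopeE[OF P] by metis
  obtain g where g: "entire g" "g z = of_real (Q z)" "\<And>x. (cmod (g x))\<^sup>2 \<le> Q z * Q x"
    using entire_envelopeE[OF Q] by metis
  have "(cmod (f x * g x))\<^sup>2 \<le> (P z * Q z) * (P x * Q x)" for x
  proof -
    have "(cmod (f x * g x))\<^sup>2 = (cmod (f x))\<^sup>2 * (cmod (g x))\<^sup>2" by (simp add: norm_mult power_mult_distrib)
    also have "\<dots> \<le> (P z * P x) * (Q z * Q x)"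
      by (intro mult_mono f g) (simp_all add: P Q entire_envelope_nonneg)
    finally show ?thesis by (simp add: mult_ac)
  qed
  then show "\<exists>h. entire h \<and> h z = of_real (P z * Q z) \<and> (\<forall>x. (cmod (h x))\<^sup>2 \<le> (P z * Q z) * (P x * Q x))"
    by (intro exI[of _ "\<lambda>x. f x * g x"]) (simp add: entire_mult f g)
qed

lemma entire_envelope_const: "0 \<le> c \<Longrightarrow> entire_envelope (\<lambda>_. c)"
  using entire_envelope_norm[of "\<lambda>_. of_real (sqrt c)"] by simp

lemma entire_envelope_sum:
  "finite I \<Longrightarrow> (\<And>i. i \<in> I \<Longrightarrow> entire_envelope (f i)) \<Longrightarrow> entire_envelope (\<lambda>x. \<Sum>i\<in>I. f i x)"
proof (induction I rule: finite_induct)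
  case empty
  show ?case using entire_envelope_const[of 0] by simp
next
  case (insert i I)
  then have "entire_envelope (\<lambda>x. f i x + (\<Sum>i\<in>I. f i x))"
    by (intro entire_envelope_add) auto
  then show ?case using insert.hyps by simp
qed

text \<open>Cauchy's integral formula on the unit circle.\<close>

lemma circle_mean_value:
  fixes g :: "complex \<Rightarrow> complex"
  assumes "g holomorphic_on UNIV"
  shows "((\<lambda>t. g (cis t)) has_integral 2 * pi * g 0) {0..2 * pi}"
proof -
  have "((\<lambda>u. g u / (u - 0)) has_contour_integral 2 * of_real pi * \<i> * g 0) (circlepath 0 1)"
    by (rule Cauchy_integral_circlepath_simple) (use assms in \<open>auto intro: holomorphic_on_subset\<close>)
  then have "((\<lambda>t. g (cis t) / cis t * (\<i> * cis t)) has_integral 2 * of_real pi * \<i> * g 0) {0..2 * pi}"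
    by (simp add: circlepath_def has_contour_integral_part_circlepath_iff mult_ac)
  then have "((\<lambda>t. g (cis t) * \<i>) has_integral 2 * of_real pi * g 0 * \<i>) {0..2 * pi}"
    by (simp add: mult_ac)
  from has_integral_mult_left[OF this, of "- \<i>"] show ?thesis
    by (simp add: mult_ac)
qed

lemma continuous_cis_line:
  "continuous_on UNIV P \<Longrightarrow> continuous_on A (\<lambda>t. P (z + cis t *s (w :: complex^'n)))"
  by (rule continuous_on_compose2[of UNIV P])
     (auto simp: vector_scalar_mult_def intro!: continuous_intros)

text \<open>The function \<open>f\<close> that touches the envelope at \<open>z\<close> has the mean value \<open>f z = P z\<close>, while
  \<open>\<bar>f\<bar> \<le> \<surd>(P z P) \<le> (P z + P) / 2\<close>.\<close>

lemma entire_envelope_submean: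
  assumes P: "entire_envelope P" and cont: "continuous_on UNIV P"
  shows "2 * pi * P z \<le> integral {0..2 * pi} (\<lambda>t. P (z + cis t *s w))"
proof -
  obtain f where f: "entire f" "f z = of_real (P z)" "\<And>x. (cmod (f x))\<^sup>2 \<le> P z * P x"
    using entire_envelopeE[OF P] by metis
  have int: "(\<lambda>t. P (z + cis t *s w)) integrable_on {0..2 * pi}"
    by (intro integrable_continuous_interval continuous_cis_line cont)
  have mv: "((\<lambda>t. f (z + cis t *s w)) has_integral 2 * pi * f z) {0..2 * pi}"
    using circle_mean_value[of "\<lambda>\<zeta>. f (z + \<zeta> *s w)"] f(1) by (simp add: entire_def)
  have bound: "cmod (f x) \<le> (P z + P x) / 2" for x
  proof (rule power2_le_imp_le)
    have "((P z + P x) / 2)\<^sup>2 = P z * P x + ((P z - P x) / 2)\<^sup>2" by (simp add: power2_eq_square field_simps)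
    then show "(cmod (f x))\<^sup>2 \<le> ((P z + P x) / 2)\<^sup>2" using f(3)[of x] by (smt (verit) zero_le_power2)
  qed (simp add: P entire_envelope_nonneg)
  have "cmod (integral {0..2 * pi} (\<lambda>t. f (z + cis t *s w))) \<le>
      integral {0..2 * pi} (\<lambda>t. (P z + P (z + cis t *s w)) / 2)"
    by (rule integral_norm_bound_integral)
       (use mv int bound in \<open>auto intro!: integrable_add integrable_on_divide simp: has_integral_integrable\<close>)
  also have "integral {0..2 * pi} (\<lambda>t. (P z + P (z + cis t *s w)) / 2) =
      (2 * pi * P z + integral {0..2 * pi} (\<lambda>t. P (z + cis t *s w))) / 2"
  proof (rule integral_unique)
    show "((\<lambda>t. (P z + P (z + cis t *s w)) / 2) has_integral
        (2 * pi * P z + integral {0..2 * pi} (\<lambda>t. P (z + cis t *s w))) / 2) {0..2 * pi}"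
      using has_integral_divide[OF has_integral_add[OF has_integral_const_real[of "P z" 0 "2 * pi"]
          integrable_integral[OF int]], of 2] by simp
  qed
  finally show ?thesis
    using integral_unique[OF mv] f(2) entire_envelope_nonneg[OF P, of z] by (simp add: norm_mult)
qed

lemma bounded_sublevel:
  fixes P :: "'a::real_normed_vector \<Rightarrow> real"
  assumes "0 < \<kappa>" "\<And>x. \<kappa> * norm x ^ 4 \<le> P x"
  shows "bounded {x. P x \<le> c}"
proof -
  have "norm x \<le> 1 + c / \<kappa>" if "P x \<le> c" for x
  proof (cases "norm x \<le> 1")
    case True
    have "0 \<le> P x" using assms(2)[of x] assms(1) by (smt (verit) mult_nonneg_nonneg norm_ge_zero zero_le_power)
    then have "0 \<le> c / \<kappa>" using that assms(1) by simp
    then show ?thesis using True by simp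
  next
    case False
    then have "norm x \<le> norm x ^ 4" by (intro self_le_power) auto
    then have "\<kappa> * norm x \<le> c" using assms(1) assms(2)[of x] that by (smt (verit) mult_left_mono)
    then have "norm x \<le> c / \<kappa>" using assms(1) by (simp add: field_simps)
    then show ?thesis by simp
  qed
  then show ?thesis by (intro boundedI[of _ "1 + c / \<kappa>"]) auto
qed

text \<open>The function \<open>1 / (1 - P)\<close> is an exhaustion: it is a convex increasing function of \<open>P\<close>, and it
  tends to infinity at the boundary, the set being bounded by the growth condition.\<close>

lemma pseudoconvex_sublevel:
  fixes P :: "complex^'n \<Rightarrow> real"
  assumes P: "entire_envelope P" and cont: "continuous_on UNIV P"
    and \<kappa>: "0 < \<kappa>" "\<And>x. \<kappa> * norm x ^ 4 \<le> P x"
  shows "pseudoconvex {x. P x < 1}"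
  unfolding pseudoconvex_def
proof (intro conjI exI allI)
  let ?D = "{x. P x < 1}" and ?u = "\<lambda>x. 1 / (1 - P x)"
  show "open ?D" using open_Collect_less[OF cont continuous_on_const] .
  have contu: "continuous_on ?D ?u"
    by (intro continuous_intros continuous_on_subset[OF cont]) auto
  show "continuous_plurisubharmonic_on ?u ?D"
    unfolding continuous_plurisubharmonic_on_def
  proof (intro conjI allI impI contu)
    fix z w assume D: "\<forall>\<zeta>. cmod \<zeta> \<le> 1 \<longrightarrow> z + \<zeta> *s w \<in> ?D"
    define a where "a = P z"
    have "a < 1" using D[rule_format, of 0] by (simp add: a_def)
    have lt: "P (z + cis t *s w) < 1" for t using D[rule_format, of "cis t"] by simp
    let ?p = "\<lambda>t. P (z + cis t *s w)"
    have cp: "continuous_on {0..2 * pi} ?p" by (rule continuous_cis_line[OF cont])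
    have cu: "continuous_on {0..2 * pi} (\<lambda>t. ?u (z + cis t *s w))"
      using lt by (intro continuous_intros cp) (metis diff_gt_0_iff_gt less_irrefl)
    \<comment> \<open>The tangent line of the convex function \<open>y \<mapsto> 1 / (1 - y)\<close> at \<open>a\<close> turns the sub-mean value
      inequality of \<open>P\<close> into that of the composition.\<close>
    have tangent: "1 / (1 - a) + (y - a) / (1 - a)\<^sup>2 \<le> 1 / (1 - y)" if "y < 1" for y
    proof -
      have "1 / (1 - y) - (1 / (1 - a) + (y - a) / (1 - a)\<^sup>2) = (y - a)\<^sup>2 / ((1 - a)\<^sup>2 * (1 - y))"
        using that \<open>a < 1\<close> by (simp add: divide_simps) (simp add: power2_eq_square algebra_simps)
      moreover have "\<dots> \<ge> 0" using that by simp
      ultimately show ?thesis by linarith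
    qed
    have ip: "?p integrable_on {0..2 * pi}" by (rule integrable_continuous_interval[OF cp])
    have sub: "0 \<le> (integral {0..2 * pi} ?p - 2 * pi * a) / (1 - a)\<^sup>2"
      using entire_envelope_submean[OF P cont, of z w] by (simp add: a_def)
    have "2 * pi * (1 / (1 - a)) \<le> 2 * pi * (1 / (1 - a)) + (integral {0..2 * pi} ?p - 2 * pi * a) / (1 - a)\<^sup>2"
      using sub by simp
    also have "\<dots> = integral {0..2 * pi} (\<lambda>t. 1 / (1 - a) + (?p t - a) / (1 - a)\<^sup>2)"
    proof (rule integral_unique[symmetric])
      show "((\<lambda>t. 1 / (1 - a) + (?p t - a) / (1 - a)\<^sup>2) has_integral
          2 * pi * (1 / (1 - a)) + (integral {0..2 * pi} ?p - 2 * pi * a) / (1 - a)\<^sup>2) {0..2 * pi}"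
        using has_integral_add[OF has_integral_const_real[of "1 / (1 - a)" 0 "2 * pi"]
          has_integral_divide[OF has_integral_diff[OF integrable_integral[OF ip]
            has_integral_const_real[of a 0 "2 * pi"]], of "(1 - a)\<^sup>2"]]
        by simp
    qed
    also have "\<dots> \<le> integral {0..2 * pi} (\<lambda>t. ?u (z + cis t *s w))"
      by (rule integral_le)
         (use lt tangent ip in \<open>auto intro!: integrable_add integrable_diff integrable_on_divide
            integrable_continuous_interval[OF cu]\<close>)
    finally show "?u z \<le> 1 / (2 * pi) * integral {0..2 * pi} (\<lambda>t. ?u (z + cis t *s w))"
      by (simp add: a_def field_simps)
  qed
  fix c :: real
  show "compact {z \<in> ?D. ?u z \<le> c}"
  proof (cases "0 < c")
    case True
    have "y < 1 \<and> 1 / (1 - y) \<le> c \<longleftrightarrow> y \<le> 1 - 1 / c" for y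
    proof
      assume y: "y < 1 \<and> 1 / (1 - y) \<le> c"
      then have "1 \<le> c * (1 - y)" by (simp add: divide_le_eq)
      then show "y \<le> 1 - 1 / c" using True by (simp add: field_simps)
    next
      assume y: "y \<le> 1 - 1 / c"
      have "0 < 1 / c" using True by simp
      with y have "y < 1" by linarith
      moreover have "1 \<le> c * (1 - y)" using y True by (simp add: field_simps)
      ultimately show "y < 1 \<and> 1 / (1 - y) \<le> c" by (simp add: divide_le_eq)
    qed
    then have "{z \<in> ?D. ?u z \<le> c} = {z. P z \<le> 1 - 1 / c}" by simp
    moreover have "closed {z. P z \<le> 1 - 1 / c}" by (rule closed_Collect_le[OF cont continuous_on_const])
    ultimately show ?thesis using bounded_sublevel[OF \<kappa>] by (simp add: compact_eq_bounded_closed)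
  next
    case False
    have "\<not> 1 / (1 - P z) \<le> c" if "P z < 1" for z
    proof -
      have "0 < 1 / (1 - P z)" using that by simp
      then show ?thesis using False by linarith
    qed
    then have "{z \<in> ?D. ?u z \<le> c} = {}" by blast
    then show ?thesis by (simp only: compact_empty)
  qed
qed

section \<open>Circular families of sublevel sets\<close>

definition sublevel_family :: "(complex^'n \<Rightarrow> real) \<Rightarrow> (complex^'n \<Rightarrow> real) \<Rightarrow> real \<Rightarrow> (complex \<times> (complex^'n)) set" where
  "sublevel_family P R \<rho> = {(w, x). cmod w < \<rho> \<and> P x + (cmod w)\<^sup>2 * R x < 1}"

lemma holomorphic_in_coords_affine:
  assumes f: "entire f" and g: "entire g"
  shows "holomorphic_in_coords W (\<lambda>(w, x). f x + c * w * g x)"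
proof -
  have line: "(\<lambda>v. h (update_coord x j v)) field_differentiable at a" if "entire h" for h x j a
  proof -
    have "(\<lambda>v. h ((x - (x $ j) *s axis j 1) + v *s axis j 1)) holomorphic_on UNIV"
      using that unfolding entire_def by blast
    then show ?thesis
      unfolding update_coord_line by (simp add: holomorphic_on_def)
  qed
  have "continuous_on A f" "continuous_on A g" for A
    using f g by (auto simp: entire_def intro: continuous_on_subset)
  note fg = this
  have e: "entire (\<lambda>x. f x + c * a * g x)" for a by (intro entire_add entire_mult entire_const f g)
  from fg have "continuous_on W (\<lambda>p. f (snd p) + c * fst p * g (snd p))"
    by (intro continuous_on_add continuous_on_mult continuous_on_const continuous_on_fst continuous_on_id
        continuous_on_compose2[of UNIV f W snd] continuous_on_compose2[of UNIV g W snd] continuous_on_snd) auto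
  then show ?thesis
    unfolding holomorphic_in_coords_def
    by (auto simp: case_prod_beta intro!: field_differentiable_add field_differentiable_mult
        field_differentiable_const field_differentiable_ident line[OF f] line[OF g])
qed

context
  fixes P R :: "complex^'n \<Rightarrow> real" and \<rho> \<kappa> :: real
  assumes P: "entire_envelope P" "continuous_on UNIV P"
    and R: "entire_envelope R" "continuous_on UNIV R"
    and \<kappa>: "0 < \<kappa>" "\<And>x. \<kappa> * norm x ^ 4 \<le> P x"
begin

lemma continuous_sublevel_family: "continuous_on A (\<lambda>p. P (snd p) + (cmod (fst p))\<^sup>2 * R (snd p))"
  by (intro continuous_on_add continuous_on_mult continuous_on_power continuous_on_norm continuous_on_fst
      continuous_on_id continuous_on_compose2[OF P(2), of A snd] continuous_on_compose2[OF R(2), of A snd]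
      continuous_on_snd) auto

lemma open_sublevel_family: "open (sublevel_family P R \<rho>)"
proof -
  have "sublevel_family P R \<rho> = {p. cmod (fst p) < \<rho>} \<inter> {p. P (snd p) + (cmod (fst p))\<^sup>2 * R (snd p) < 1}"
    by (auto simp: sublevel_family_def)
  then show ?thesis
    using continuous_sublevel_family[of UNIV]
    by (auto intro!: open_Int open_Collect_less continuous_on_norm continuous_on_fst continuous_on_id continuous_on_const)
qed

text \<open>If \<open>p = (w, z)\<close> and \<open>f\<close>, \<open>g\<close> touch \<open>P\<close>, \<open>R\<close> at \<open>z\<close>, then \<open>F (v, x) = f x + cnj w v g x\<close> touches
  \<open>Q (v, x) = P x + \<bar>v\<bar>\<^sup>2 R x\<close> at \<open>p\<close>: \<open>F p = Q p\<close> and \<open>\<bar>F\<bar>\<^sup>2 \<le> Q p Q\<close>. If \<open>p\<close> is in the hull of \<open>K\<close>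
  and \<open>Q \<le> m < 1\<close> on \<open>K\<close>, it follows that \<open>(Q p)\<^sup>2 \<le> Q p m\<close>, so \<open>Q p \<le> m\<close>. The coordinate \<open>w\<close> bounds
  the hull away from the boundary of the disc.\<close>

lemma stein_sublevel_family: "stein_manifold (domain_over_disc (sublevel_family P R \<rho>))"
proof (rule stein_domain_over_disc[OF open_sublevel_family])
  let ?W = "sublevel_family P R \<rho>"
  define Q where "Q = (\<lambda>p. P (snd p) + (cmod (fst p))\<^sup>2 * R (snd p))"
  have Q0: "0 \<le> Q p" for p
    using P R by (simp add: Q_def entire_envelope_nonneg)
  fix K assume K: "compact K" "K \<subseteq> ?W"
  have "\<exists>L. compact L \<and> L \<subseteq> ?W \<and>
        (\<forall>p\<in>?W. (\<forall>F B. holomorphic_in_coords ?W F \<longrightarrow> (\<forall>k\<in>K. cmod (F k) \<le> B) \<longrightarrow> cmod (F p) \<le> B) \<longrightarrow> p \<in> L)"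
  proof (cases "K = {}")
    case True
    have "holomorphic_in_coords ?W (\<lambda>_. 0)"
      by (simp add: holomorphic_in_coords_def field_differentiable_const case_prod_beta)
    then have nH: "\<not> (\<forall>F B. holomorphic_in_coords ?W F \<longrightarrow> (\<forall>k\<in>K. cmod (F k) \<le> B) \<longrightarrow> cmod (F p) \<le> B)" for p
      using True by (intro notI) (drule spec[of _ "\<lambda>_. 0"], drule spec[of _ "-1"], simp)
    show ?thesis
      by (intro exI[of _ "{}"] conjI compact_empty empty_subsetI ballI impI) (rule notE[OF nH])
  next
    case False
    have contQ: "continuous_on A Q" for A unfolding Q_def by (rule continuous_sublevel_family)
    obtain k1 where k1: "k1 \<in> K" "\<And>k. k \<in> K \<Longrightarrow> Q k \<le> Q k1"
      using continuous_attains_sup[OF K(1) False contQ] by metis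
    obtain k2 where k2: "k2 \<in> K" "\<And>k. k \<in> K \<Longrightarrow> cmod (fst k) \<le> cmod (fst k2)"
      using continuous_attains_sup[OF K(1) False continuous_on_norm[OF continuous_on_fst[OF continuous_on_id]]]
      by metis
    define m where "m = Q k1"
    define a where "a = cmod (fst k2)"
    have m: "0 \<le> m" "m < 1" and a: "a < \<rho>"
      using Q0 k1(1) k2(1) K(2) by (auto simp: m_def a_def Q_def sublevel_family_def)
    define L where "L = {p. cmod (fst p) \<le> a} \<inter> {p. Q p \<le> m}"
    have "L \<subseteq> cball 0 a \<times> {x. P x \<le> m}"
      using R by (auto simp: L_def Q_def entire_envelope_nonneg)
        (smt (verit) entire_envelope_nonneg mult_nonneg_nonneg zero_le_power2)
    moreover have "bounded (cball (0::complex) a \<times> {x. P x \<le> m})"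
      by (intro bounded_Times bounded_cball bounded_sublevel[OF \<kappa>])
    ultimately have "bounded L" by (rule bounded_subset[rotated])
    moreover have "closed L"
      unfolding L_def
      by (intro closed_Int closed_Collect_le contQ continuous_on_const continuous_on_norm continuous_on_fst continuous_on_id)
    ultimately have "compact L" by (simp add: compact_eq_bounded_closed)
    moreover have "L \<subseteq> ?W" using m a by (auto simp: L_def Q_def sublevel_family_def)
    moreover have "p \<in> L"
      if H: "\<And>F B. holomorphic_in_coords ?W F \<Longrightarrow> (\<And>k. k \<in> K \<Longrightarrow> cmod (F k) \<le> B) \<Longrightarrow> cmod (F p) \<le> B" for p
    proof -
      obtain w z where p: "p = (w, z)" by (cases p)
      obtain f where f: "entire f" "f z = of_real (P z)" "\<And>x. (cmod (f x))\<^sup>2 \<le> P z * P x"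
        using entire_envelopeE[OF P(1)] by metis
      obtain g where g: "entire g" "g z = of_real (R z)" "\<And>x. (cmod (g x))\<^sup>2 \<le> R z * R x"
        using entire_envelopeE[OF R(1)] by metis
      \<comment> \<open>The conjugate makes \<open>F\<close> real and equal to \<open>Q\<close> at \<open>p\<close>.\<close>
      define F where "F = (\<lambda>(v, x). f x + cnj w * v * g x)"
      have "F p = of_real (Q p)"
        using complex_norm_square[of w] by (simp add: F_def Q_def p f(2) g(2) mult.commute)
      moreover have "(cmod (F k))\<^sup>2 \<le> Q p * Q k" for k
      proof -
        obtain v x where k: "k = (v, x)" by (cases k)
        have "(cmod (cnj w * v * g x))\<^sup>2 = (cmod w)\<^sup>2 * (cmod v)\<^sup>2 * (cmod (g x))\<^sup>2"
          by (simp add: norm_mult power_mult_distrib)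
        also have "\<dots> \<le> (cmod w)\<^sup>2 * (cmod v)\<^sup>2 * (R z * R x)"
          by (intro mult_left_mono g) simp
        also have "\<dots> = ((cmod w)\<^sup>2 * R z) * ((cmod v)\<^sup>2 * R x)" by simp
        finally show ?thesis
          unfolding F_def k Q_def p prod.case fst_conv snd_conv
          by (intro cauchy_schwarz_sum f(3)) (simp_all add: P R entire_envelope_nonneg)
      qed
      then have "cmod (F k) \<le> sqrt (Q p * m)" if "k \<in> K" for k
        using k1(2)[OF that] Q0[of p] unfolding m_def
        by (intro real_le_rsqrt) (meson mult_left_mono order_trans)
      then have "cmod (F p) \<le> sqrt (Q p * m)"
        by (rule H[rotated], simp)
           (unfold F_def, rule holomorphic_in_coords_affine[OF f(1) g(1)])
      ultimately have "Q p \<le> sqrt (Q p * m)" using Q0[of p] by simp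
      then have "(Q p)\<^sup>2 \<le> (sqrt (Q p * m))\<^sup>2" using Q0[of p] by (rule power_mono)
      then have "(Q p)\<^sup>2 \<le> Q p * m" using Q0[of p] m by simp
      then have "Q p \<le> m" using Q0[of p] m(1)
        by (cases "Q p = 0") (auto simp: power2_eq_square)
      moreover have "cmod (fst p) \<le> a"
      proof -
        have "holomorphic_in_coords ?W fst"
          using holomorphic_in_coords_affine[OF entire_const[of 0] entire_const[of 1], of ?W 1]
          by (simp add: case_prod_beta')
        then show ?thesis by (rule H) (use k2(2) in \<open>simp add: a_def\<close>)
      qed
      ultimately show ?thesis by (simp add: L_def)
    qed
    ultimately show ?thesis by (intro exI[of _ L]) blast
  qed
  then show "\<exists>L. compact L \<and> L \<subseteq> ?W \<and>
        (\<forall>p\<in>?W. (\<forall>F B. holomorphic_in_coords ?W F \<longrightarrow> (\<forall>k\<in>K. cmod (F k) \<le> B) \<longrightarrow> cmod (F p) \<le> B) \<longrightarrow> p \<in> L)" .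
qed

lemma fiber_sublevel_family:
  assumes "s \<in> topspace (points (base_disc \<rho>))"
  shows "fiber (lift ` sublevel_family P R \<rho>) s = {x. P x + (cmod (s 0))\<^sup>2 * R x < 1}"
proof -
  from assms obtain w where w: "s = disc_point w" "cmod w < \<rho>" by auto
  have "(s, x) \<in> lift ` sublevel_family P R \<rho> \<longleftrightarrow> (w, x) \<in> sublevel_family P R \<rho>" for x
    using inj_image_mem_iff[OF inj_lift, of "(w, x)"] by (simp add: lift_def w(1))
  then show ?thesis using w by (simp add: fiber_def sublevel_family_def)
qed

lemma pseudoconvex_family_sublevel_family:
  assumes "P 0 = 0" "R 0 = 0"
  shows "pseudoconvex_family (base_disc \<rho>) (lift ` sublevel_family P R \<rho>)"
  unfolding pseudoconvex_family_def family_of_pseudoconvex_open_sets_def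
proof (intro conjI ballI)
  let ?W = "sublevel_family P R \<rho>"
  have sub: "?W \<subseteq> ball 0 \<rho> \<times> UNIV" by (auto simp: sublevel_family_def)
  then show "openin (prod_topology (points (base_disc \<rho>)) euclidean) (lift ` ?W)"
    using openin_base_disc open_sublevel_family by blast
  have "ball 0 \<rho> \<times> {0} \<subseteq> ?W" using assms by (auto simp: sublevel_family_def)
  then show "topspace (points (base_disc \<rho>)) \<times> {0} \<subseteq> lift ` ?W"
    using image_mono[of _ ?W lift] by (simp only: lift_image_times[symmetric] topspace_base_disc)
  show "stein_manifold (open_submanifold (times_Cn (base_disc \<rho>)) (lift ` ?W))"
    unfolding open_submanifold_times_Cn_base_disc[OF sub] by (rule stein_sublevel_family)
  fix s assume "s \<in> topspace (points (base_disc \<rho>))"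
  then have "fiber (lift ` ?W) s = {x. P x + (cmod (s 0))\<^sup>2 * R x < 1}" by (rule fiber_sublevel_family)
  moreover have "pseudoconvex {x. P x + (cmod (s 0))\<^sup>2 * R x < 1}"
  proof (rule pseudoconvex_sublevel[OF _ _ \<kappa>(1)])
    show "entire_envelope (\<lambda>x. P x + (cmod (s 0))\<^sup>2 * R x)"
      by (intro entire_envelope_add entire_envelope_mult entire_envelope_const P R) simp
    show "continuous_on UNIV (\<lambda>x. P x + (cmod (s 0))\<^sup>2 * R x)"
      by (intro continuous_on_add continuous_on_mult continuous_on_const P R)
    show "\<kappa> * norm x ^ 4 \<le> P x + (cmod (s 0))\<^sup>2 * R x" for x
      using \<kappa>(2)[of x] entire_envelope_nonneg[OF R(1), of x] by (smt (verit) mult_nonneg_nonneg zero_le_power2)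
  qed
  ultimately show "pseudoconvex (fiber (lift ` ?W) s)" by simp
qed

end

text \<open>For \<open>x \<in> T 1\<close> the circles \<open>{(w, \<tau> x). \<bar>w\<bar> = 1}\<close>, \<open>0 \<le> \<tau> \<le> 1\<close>, lie in the family because its fibers are
  rotation invariant in \<open>w\<close> and star shaped. The continuity principle fills in the discs.\<close>

lemma rotation_invariant_family_largest_at_center:
  fixes T :: "real \<Rightarrow> (complex^'n) set"
  assumes \<rho>: "1 < \<rho>"
    and fam: "pseudoconvex_family (base_disc \<rho>) (\<Union>s\<in>topspace (points (base_disc \<rho>)). {s} \<times> T (cmod (s 0)))"
    and star: "\<And>r \<tau> x. x \<in> T r \<Longrightarrow> 0 \<le> \<tau> \<Longrightarrow> \<tau> \<le> 1 \<Longrightarrow> \<tau> *\<^sub>R x \<in> T r"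
  shows "T 1 \<subseteq> T 0"
proof
  fix x assume x: "x \<in> T 1"
  let ?Z = "\<Union>s\<in>topspace (points (base_disc \<rho>)). {s} \<times> T (cmod (s 0))"
  define W where "W = {(w, x). cmod w < \<rho> \<and> x \<in> T (cmod w)}"
  have Z: "?Z = lift ` W"
    unfolding topspace_base_disc by (auto simp: W_def lift_def image_iff)
  have sub: "W \<subseteq> ball 0 \<rho> \<times> UNIV" by (auto simp: W_def)
  have "openin (prod_topology (points (base_disc \<rho>)) euclidean) (lift ` W)"
    using fam unfolding Z pseudoconvex_family_def family_of_pseudoconvex_open_sets_def by (elim conjE)
  then obtain W' where "lift ` W = lift ` W'" "open W'"
    unfolding openin_base_disc by (elim exE conjE)
  then have W: "open W" by (simp only: inj_image_eq_iff[OF inj_lift])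
  have "ball 0 \<rho> \<times> {0} \<subseteq> W"
  proof -
    have "topspace (points (base_disc \<rho>)) \<times> {0} \<subseteq> lift ` W"
      using fam unfolding Z pseudoconvex_family_def family_of_pseudoconvex_open_sets_def by (elim conjE)
    then have "lift ` (ball 0 \<rho> \<times> {0}) \<subseteq> lift ` W"
      by (simp only: topspace_base_disc lift_image_times)
    then show ?thesis by (simp only: inj_image_subset_iff[OF inj_lift])
  qed
  moreover have "cball 0 1 \<subseteq> ball (0::complex) \<rho>" using \<rho> by auto
  ultimately have zero: "cball 0 1 \<times> {0} \<subseteq> W" by blast
  have "stein_manifold (domain_over_disc W)"
    using fam unfolding Z pseudoconvex_family_def open_submanifold_times_Cn_base_disc[OF sub] by (elim conjE)
  then have "cball 0 1 \<times> {x} \<subseteq> W"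
    by (rule continuity_principle[OF W _ zero]) (use x \<rho> star in \<open>auto simp: W_def\<close>)
  moreover have "(0, x) \<in> cball 0 1 \<times> {x}" by simp
  ultimately have "(0, x) \<in> W" by (rule subsetD)
  then show "x \<in> T 0" by (simp add: W_def)
qed

section \<open>Sublevel sets of quartics\<close>

lemma real_polynomial_function_has_derivative:
  fixes F :: "'a::real_normed_vector \<Rightarrow> real"
  assumes "real_polynomial_function F"
  shows "\<exists>F'. (\<forall>x. (F has_derivative F' x) (at x)) \<and> (\<forall>v. real_polynomial_function (\<lambda>x. F' x v))"
  using assms
proof induction
  case (linear f)
  then have "\<forall>x. (f has_derivative f) (at x)" by (simp add: bounded_linear_imp_has_derivative)
  then show ?case by (intro exI[of _ "\<lambda>_. f"]) (simp add: real_polynomial_function.intros(2))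
next
  case (const c)
  show ?case by (rule exI[of _ "\<lambda>_ _. 0"]) (simp add: real_polynomial_function.intros(2))
next
  case (add f g)
  then obtain f' g' where "\<And>x. (f has_derivative f' x) (at x)" "\<And>x. (g has_derivative g' x) (at x)"
    "\<And>v. real_polynomial_function (\<lambda>x. f' x v)" "\<And>v. real_polynomial_function (\<lambda>x. g' x v)"
    by blast
  then show ?case
    by (intro exI[of _ "\<lambda>x v. f' x v + g' x v"]) (simp add: has_derivative_add real_polynomial_function.intros(3))
next
  case (mult f g)
  then obtain f' g' where "\<And>x. (f has_derivative f' x) (at x)" "\<And>x. (g has_derivative g' x) (at x)"
    "\<And>v. real_polynomial_function (\<lambda>x. f' x v)" "\<And>v. real_polynomial_function (\<lambda>x. g' x v)"
    by blast
  with mult.hyps show ?case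
    by (intro exI[of _ "\<lambda>x v. f x * g' x v + f' x v * g x"])
       (simp add: has_derivative_mult real_polynomial_function.intros(3) real_polynomial_function.intros(4))
qed

lemma frechet_derivative_polynomial:
  assumes "real_polynomial_function F"
  shows "(F has_derivative frechet_derivative F (at x)) (at x)"
    and "real_polynomial_function (\<lambda>x. frechet_derivative F (at x) v)"
proof -
  obtain F' where F': "\<And>x. (F has_derivative F' x) (at x)" "\<And>v. real_polynomial_function (\<lambda>x. F' x v)"
    using real_polynomial_function_has_derivative[OF assms] by blast
  then have "frechet_derivative F (at x) = F' x" for x
    by (metis frechet_derivative_at)
  then show "(F has_derivative frechet_derivative F (at x)) (at x)"
    "real_polynomial_function (\<lambda>x. frechet_derivative F (at x) v)"
    using F' by simp_all
qed

lemma continuous_on_polynomial: "real_polynomial_function F \<Longrightarrow> continuous_on A F"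
  by (meson continuous_at_imp_continuous_on frechet_derivative_polynomial(1) has_derivative_continuous)

lemma Ck_on_polynomial: "real_polynomial_function F \<Longrightarrow> Ck_on k F U"
proof (induction k arbitrary: F)
  case 0
  then show ?case by (simp add: continuous_on_polynomial)
next
  case (Suc k)
  then show ?case
    using frechet_derivative_polynomial[OF Suc.prems] by (auto simp: differentiable_def)
qed

lemma has_derivative_along_line:
  fixes F :: "'a::real_normed_vector \<Rightarrow> real"
  assumes "(F has_derivative F') (at (p + t *\<^sub>R v))"
  shows "((\<lambda>t. F (p + t *\<^sub>R v)) has_real_derivative F' v) (at t)"
proof -
  have "((\<lambda>t. p + t *\<^sub>R v) has_derivative (\<lambda>s. s *\<^sub>R v)) (at t)"
    by (auto intro!: derivative_eq_intros)
  from diff_chain_at[OF this assms] have "((\<lambda>t. F (p + t *\<^sub>R v)) has_derivative (\<lambda>s. F' (s *\<^sub>R v))) (at t)"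
    by (simp add: o_def)
  moreover have "F' (s *\<^sub>R v) = s * F' v" for s
    using has_derivative_linear[OF assms] by (simp add: linear_scale)
  ultimately show ?thesis by (simp add: has_field_derivative_def mult_commute_abs)
qed

text \<open>Both derivatives are those of a polynomial in one variable, so they can be read off from the
  expansion along the line.\<close>

lemma derivatives_along_line:
  fixes F :: "'a::real_normed_vector \<Rightarrow> real"
  assumes F: "real_polynomial_function F"
    and line: "\<And>t. F (p + t *\<^sub>R v) = c0 + c1 * t + c2 * t^2 + c3 * t^3 + c4 * t^4"
  shows "frechet_derivative F (at p) v = c1"
    and "frechet_derivative (\<lambda>x. frechet_derivative F (at x) v) (at p) v = 2 * c2"
proof -
  let ?g = "\<lambda>x. frechet_derivative F (at x) v"
  have g: "?g (p + t *\<^sub>R v) = c1 + 2 * c2 * t + 3 * c3 * t^2 + 4 * c4 * t^3" for t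
  proof (rule DERIV_unique)
    show "((\<lambda>t. F (p + t *\<^sub>R v)) has_real_derivative ?g (p + t *\<^sub>R v)) (at t)"
      by (rule has_derivative_along_line[OF frechet_derivative_polynomial(1)[OF F]])
    show "((\<lambda>t. F (p + t *\<^sub>R v)) has_real_derivative c1 + 2 * c2 * t + 3 * c3 * t^2 + 4 * c4 * t^3) (at t)"
      unfolding line by (auto intro!: derivative_eq_intros)
  qed
  from g[of 0] show "?g p = c1" by simp
  show "frechet_derivative ?g (at p) v = 2 * c2"
  proof (rule DERIV_unique)
    show "((\<lambda>t. ?g (p + t *\<^sub>R v)) has_real_derivative frechet_derivative ?g (at p) v) (at 0)"
      by (rule has_derivative_along_line)
         (use frechet_derivative_polynomial(1)[OF frechet_derivative_polynomial(2)[OF F]] in simp)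
    show "((\<lambda>t. ?g (p + t *\<^sub>R v)) has_real_derivative 2 * c2) (at 0)"
      unfolding g by (auto intro!: derivative_eq_intros)
  qed
qed

text \<open>Besides homogeneity, \<open>q p v\<close> is the coefficient of \<open>t\<^sup>2\<close> along the line \<open>p + t v\<close>, that is, half
  of the second derivative of \<open>F\<close> at \<open>p\<close> in the direction \<open>v\<close>. In this form it is linear in \<open>F\<close> and
  can be computed without differentiating.\<close>

definition quartic :: "(complex^'n \<Rightarrow> real) \<Rightarrow> (complex^'n \<Rightarrow> complex^'n \<Rightarrow> real) \<Rightarrow> bool" where
  "quartic F q \<longleftrightarrow> real_polynomial_function F \<and> (\<forall>c x. F (c *s x) = cmod c ^ 4 * F x) \<and>
     (\<forall>p v. \<exists>c1 c3 c4. \<forall>t. F (p + t *\<^sub>R v) = F p + c1 * t + q p v * t^2 + c3 * t^3 + c4 * t^4)"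

lemma scaleR_eq_scalar_mult: "t *\<^sub>R (x :: complex^'n) = of_real t *s x"
  unfolding vec_eq_iff vector_scaleR_component vector_smult_component by (simp add: scaleR_conv_of_real)

lemma quartic_scaleR: "quartic F q \<Longrightarrow> F (t *\<^sub>R x) = t ^ 4 * F x"
  by (simp add: quartic_def scaleR_eq_scalar_mult)

text \<open>\<open>F - 1\<close> is a defining function on the complement of the origin, since the derivative of \<open>F\<close> in
  the direction \<open>x\<close> is \<open>4 F x > 0\<close> by homogeneity. The sign of the normal curvature is that of the second
  derivative.\<close>

lemma quartic_sublevel_in_K':
  fixes F :: "complex^'n \<Rightarrow> real"
  assumes F: "quartic F q" and \<kappa>: "0 < \<kappa>" "\<And>x. \<kappa> * norm x ^ 4 \<le> F x"
    and pos: "\<And>p v. p \<noteq> 0 \<Longrightarrow> v \<noteq> 0 \<Longrightarrow> 0 < q p v"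
  shows "{x. F x < 1} \<in> \<K>'"
proof -
  let ?Y = "{x. F x < 1}" and ?\<rho> = "\<lambda>x. F x + (-1)"
  have poly: "real_polynomial_function F" using F by (simp add: quartic_def)
  have poly\<rho>: "real_polynomial_function ?\<rho>"
    by (intro real_polynomial_function.intros(3) poly real_polynomial_function.intros(2))
  have cont: "continuous_on A F" for A by (rule continuous_on_polynomial[OF poly])
  have F0: "F 0 = 0" using quartic_scaleR[OF F, of 0 0] by simp
  have Fpos: "0 < F x" if "x \<noteq> 0" for x
  proof -
    have "0 < \<kappa> * norm x ^ 4" using \<kappa>(1) that by simp
    then show ?thesis using \<kappa>(2)[of x] by linarith
  qed
  have Fnn: "0 \<le> F x" for x using Fpos[of x] F0 by (cases "x = 0") auto
  have "open ?Y" by (rule open_Collect_less[OF cont continuous_on_const])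
  moreover have "0 \<in> ?Y" by (simp add: F0)
  moreover have scale: "c *s x \<in> ?Y" if "cmod c \<le> 1" "x \<in> ?Y" for c x
  proof -
    have "cmod c ^ 4 * F x \<le> 1 * F x"
      by (intro mult_right_mono power_le_one norm_ge_zero that(1) Fnn)
    then show ?thesis using F that(2) by (simp add: quartic_def)
  qed
  moreover have "connected ?Y"
  proof (rule starlike_imp_connected, unfold starlike_def, intro bexI ballI subsetI)
    fix x y assume x: "x \<in> ?Y" and "y \<in> closed_segment 0 x"
    then obtain u where u: "0 \<le> u" "u \<le> 1" "y = u *\<^sub>R x" by (auto simp: in_segment)
    then show "y \<in> ?Y" using scale[OF _ x, of "of_real u"] by (simp add: scaleR_eq_scalar_mult)
  qed (simp add: F0)
  moreover have "bounded ?Y"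
    by (rule bounded_subset[OF bounded_sublevel[OF \<kappa>, of 1]]) auto
  moreover have bd: "local_defining_function ?Y p (- {0}) ?\<rho> \<and>
      (\<forall>v. v \<noteq> 0 \<and> frechet_derivative ?\<rho> (at p) v = 0 \<longrightarrow> 0 < normal_curvature ?\<rho> p v)"
    if "p \<in> frontier ?Y" for p
  proof -
    have "p \<notin> ?Y" using that \<open>open ?Y\<close> by (simp add: frontier_def interior_open)
    then have "p \<noteq> 0" using F0 by auto
    have radial: "frechet_derivative ?\<rho> (at x) x = 4 * F x" for x
    proof (rule derivatives_along_line(1)[OF poly\<rho>])
      fix t :: real
      have "x + t *\<^sub>R x = (1 + t) *\<^sub>R x" by (simp add: scaleR_add_left)
      then have "F (x + t *\<^sub>R x) = (1 + t) ^ 4 * F x" by (simp only: quartic_scaleR[OF F])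
      then show "F (x + t *\<^sub>R x) + (-1) = (F x - 1) + (4 * F x) * t + (6 * F x) * t^2 + (4 * F x) * t^3 + F x * t^4"
        by (simp add: power4_eq_xxxx power2_eq_square power3_eq_cube algebra_simps)
    qed
    have nz: "frechet_derivative ?\<rho> (at x) x \<noteq> 0" if "x \<noteq> 0" for x
      using radial[of x] Fpos[OF that] by simp
    have "local_defining_function ?Y p (- {0}) ?\<rho>"
      unfolding local_defining_function_def smooth_on_def
      using \<open>p \<noteq> 0\<close> nz Ck_on_polynomial[OF poly\<rho>] by auto
    moreover have "0 < normal_curvature ?\<rho> p v" if "v \<noteq> 0" for v
    proof -
      obtain c1 c3 c4 where c: "\<And>t. F (p + t *\<^sub>R v) = F p + c1 * t + q p v * t^2 + c3 * t^3 + c4 * t^4"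
        using F unfolding quartic_def by blast
      have "frechet_derivative (\<lambda>x. frechet_derivative ?\<rho> (at x) v) (at p) v = 2 * q p v"
        by (rule derivatives_along_line(2)[OF poly\<rho>, where ?c0.0 = "F p - 1"]) (simp add: c)
      moreover have "0 < onorm (frechet_derivative ?\<rho> (at p))"
        using nz[OF \<open>p \<noteq> 0\<close>] frechet_derivative_polynomial(1)[OF poly\<rho>]
        by (subst onorm_pos_lt) (auto intro: has_derivative_bounded_linear)
      ultimately show ?thesis
        using pos[OF \<open>p \<noteq> 0\<close> that] that by (simp add: normal_curvature_def)
    qed
    ultimately show ?thesis by blast
  qed
  ultimately show ?thesis
    unfolding \<K>'_def smoothly_bounded_def strongly_convex_def balanced_def by blast
qed

section \<open>Squares of hermitian forms\<close>

lemma norm_scalar_mult: "norm (c *s (x :: complex^'n)) = cmod c * norm x"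
  by (simp add: norm_vec_def norm_mult L2_set_right_distrib)

lemma matrix_vector_scaleR: "(A :: complex^'n^'m) *v (t *\<^sub>R x) = t *\<^sub>R (A *v x)"
  by (simp add: scaleR_eq_scalar_mult vector_scalar_commute)

lemma norm_add_scaleR_square:
  fixes a b :: "'a::real_inner"
  shows "(norm (a + t *\<^sub>R b))\<^sup>2 = (norm a)\<^sup>2 + 2 * (a \<bullet> b) * t + (norm b)\<^sup>2 * t\<^sup>2"
proof -
  have "(a + t *\<^sub>R b) \<bullet> (a + t *\<^sub>R b) = a \<bullet> a + 2 * (a \<bullet> b) * t + (b \<bullet> b) * t\<^sup>2"
    unfolding inner_add_left inner_add_right inner_scaleR_left inner_scaleR_right inner_commute[of b a]
    by (simp add: power2_eq_square algebra_simps)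
  then show ?thesis by (simp add: power2_norm_eq_inner)
qed

lemma quartic_add:
  assumes "quartic F q" "quartic G r"
  shows "quartic (\<lambda>x. F x + G x) (\<lambda>p v. q p v + r p v)"
  unfolding quartic_def
proof (intro conjI allI)
  show "real_polynomial_function (\<lambda>x. F x + G x)"
    using assms by (simp add: quartic_def real_polynomial_function.intros(3))
  show "F (c *s x) + G (c *s x) = cmod c ^ 4 * (F x + G x)" for c x
    using assms by (simp add: quartic_def algebra_simps)
  fix p v
  obtain c1 c3 c4 where c: "\<And>t. F (p + t *\<^sub>R v) = F p + c1 * t + q p v * t^2 + c3 * t^3 + c4 * t^4"
    using assms(1) unfolding quartic_def by blast
  obtain d1 d3 d4 where d: "\<And>t. G (p + t *\<^sub>R v) = G p + d1 * t + r p v * t^2 + d3 * t^3 + d4 * t^4"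
    using assms(2) unfolding quartic_def by blast
  show "\<exists>c1 c3 c4. \<forall>t. F (p + t *\<^sub>R v) + G (p + t *\<^sub>R v) =
      F p + G p + c1 * t + (q p v + r p v) * t^2 + c3 * t^3 + c4 * t^4"
    by (intro exI[of _ "c1 + d1"] exI[of _ "c3 + d3"] exI[of _ "c4 + d4"] allI) (simp add: c d algebra_simps)
qed

lemma quartic_cmult:
  assumes "quartic F q"
  shows "quartic (\<lambda>x. k * F x) (\<lambda>p v. k * q p v)"
  unfolding quartic_def
proof (intro conjI allI)
  show "real_polynomial_function (\<lambda>x. k * F x)"
    using assms by (simp add: quartic_def real_polynomial_function.intros(2,4))
  show "k * F (c *s x) = cmod c ^ 4 * (k * F x)" for c x
    using assms by (simp add: quartic_def algebra_simps)
  fix p v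
  obtain c1 c3 c4 where c: "\<And>t. F (p + t *\<^sub>R v) = F p + c1 * t + q p v * t^2 + c3 * t^3 + c4 * t^4"
    using assms(1) unfolding quartic_def by blast
  show "\<exists>c1 c3 c4. \<forall>t. k * F (p + t *\<^sub>R v) = k * F p + c1 * t + (k * q p v) * t^2 + c3 * t^3 + c4 * t^4"
    by (intro exI[of _ "k * c1"] exI[of _ "k * c3"] exI[of _ "k * c4"] allI) (simp add: c algebra_simps)
qed

definition herm :: "complex^'n^'n \<Rightarrow> complex^'n \<Rightarrow> real" where
  "herm A x = (norm (A *v x))\<^sup>2"

text \<open>Half of the second derivative of \<open>(herm A)\<^sup>2\<close>; see \<open>quartic_herm_square\<close>.\<close>

definition half_hessian :: "complex^'n^'n \<Rightarrow> complex^'n \<Rightarrow> complex^'n \<Rightarrow> real" where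
  "half_hessian A p v = 2 * herm A p * herm A v + 4 * ((A *v p) \<bullet> (A *v v))\<^sup>2"

lemma herm_nonneg [simp]: "0 \<le> herm A x"
  by (simp add: herm_def)

lemma herm_sum: "herm A x = (\<Sum>k\<in>UNIV. (cmod ((A *v x) $ k))\<^sup>2)"
  by (simp add: herm_def norm_vec_def L2_set_def sum_nonneg)

lemma entire_envelope_herm: "entire_envelope (herm A)"
proof -
  have "entire_envelope (\<lambda>x. \<Sum>k\<in>UNIV. (cmod ((A *v x) $ k))\<^sup>2)"
    by (intro entire_envelope_sum entire_envelope_norm entire_matrix_vector) simp
  then show ?thesis by (simp add: herm_sum[abs_def])
qed

lemma quartic_herm_square: "quartic (\<lambda>x. (herm A x)\<^sup>2) (half_hessian A)"
  unfolding quartic_def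
proof (intro conjI allI)
  have "bounded_linear (\<lambda>x. A *v x)"
    by (intro linear_conv_bounded_linear[THEN iffD1] linearI) (simp_all add: matrix_vector_right_distrib matrix_vector_scaleR)
  then have bl: "bounded_linear (\<lambda>x. (A *v x) \<bullet> b)" for b
    by (rule bounded_linear_compose[OF bounded_linear_inner_left])
  have "(\<lambda>x. herm A x) = (\<lambda>x. \<Sum>b\<in>Basis. ((A *v x) \<bullet> b) * ((A *v x) \<bullet> b))"
    unfolding herm_def power2_norm_eq_inner by (subst euclidean_inner) simp
  then have "real_polynomial_function (herm A)"
    using real_polynomial_function_sum[OF finite_Basis
        real_polynomial_function.intros(4)[OF real_polynomial_function.intros(1)[OF bl] real_polynomial_function.intros(1)[OF bl]]]
    by simp
  then show "real_polynomial_function (\<lambda>x. (herm A x)\<^sup>2)"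
    by (simp add: power2_eq_square real_polynomial_function.intros(4))
  show "(herm A (c *s x))\<^sup>2 = cmod c ^ 4 * (herm A x)\<^sup>2" for c x
    by (simp add: herm_def vector_scalar_commute norm_scalar_mult power_mult_distrib)
  fix p v
  let ?b = "(A *v p) \<bullet> (A *v v)"
  have "herm A (p + t *\<^sub>R v) = herm A p + 2 * ?b * t + herm A v * t\<^sup>2" for t
    unfolding herm_def matrix_vector_right_distrib matrix_vector_scaleR by (rule norm_add_scaleR_square)
  then show "\<exists>c1 c3 c4. \<forall>t. (herm A (p + t *\<^sub>R v))\<^sup>2 =
      (herm A p)\<^sup>2 + c1 * t + half_hessian A p v * t^2 + c3 * t^3 + c4 * t^4"
    by (intro exI[of _ "4 * herm A p * ?b"] exI[of _ "4 * ?b * herm A v"] exI[of _ "(herm A v)\<^sup>2"] allI)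
       (simp add: half_hessian_def power4_eq_xxxx power2_eq_square power3_eq_cube algebra_simps)
qed

text \<open>The two bounds differ only by a constant factor. So the Hessian of the square of a form controls,
  up to a constant, the Hessian of the square of any smaller form.\<close>

lemma half_hessian_bounds:
  "2 * herm A p * herm A v \<le> half_hessian A p v" "half_hessian A p v \<le> 6 * herm A p * herm A v"
proof -
  have "((A *v p) \<bullet> (A *v v))\<^sup>2 \<le> herm A p * herm A v"
    using Cauchy_Schwarz_ineq[of "A *v p" "A *v v"] by (simp add: herm_def power2_norm_eq_inner)
  then show "half_hessian A p v \<le> 6 * herm A p * herm A v" by (simp add: half_hessian_def)
qed (simp add: half_hessian_def)

lemma half_hessian_nonneg: "0 \<le> half_hessian A p v"
  by (simp add: half_hessian_def)

definition proj_on :: "'n set \<Rightarrow> complex^'n^'n" where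
  "proj_on I = (\<chi> r c. if r = c \<and> r \<in> I then 1 else 0)"

lemma herm_proj_on: "herm (proj_on I) x = (\<Sum>k\<in>I. (cmod (x $ k))\<^sup>2)"
proof -
  have "(proj_on I *v x) $ k = (if k \<in> I then x $ k else 0)" for k
  proof -
    have "(proj_on I *v x) $ k = (\<Sum>c\<in>UNIV. if c = k then (if k \<in> I then x $ k else 0) else 0)"
      unfolding proj_on_def matrix_vector_mult_def vec_lambda_beta by (intro sum.cong refl) auto
    then show ?thesis by simp
  qed
  then have "herm (proj_on I) x = (\<Sum>k\<in>UNIV. if k \<in> I then (cmod (x $ k))\<^sup>2 else 0)"
    unfolding herm_sum by (auto intro!: sum.cong)
  then show ?thesis by (simp add: sum.If_cases)
qed

lemma herm_proj_on_UNIV: "herm (proj_on UNIV) x = (norm x)\<^sup>2"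
  by (simp add: herm_proj_on norm_vec_def L2_set_def sum_nonneg)

lemma herm_proj_on_le: "herm (proj_on I) x \<le> (norm x)\<^sup>2"
  unfolding herm_proj_on_UNIV[symmetric] herm_proj_on by (rule sum_mono2) auto

definition cinner :: "complex^'n \<Rightarrow> complex^'n \<Rightarrow> complex" where
  "cinner u x = (\<Sum>c\<in>UNIV. cnj (u $ c) * x $ c)"

text \<open>Multiplication by \<open>\<surd>a\<close> along the unit vector \<open>u\<close> and by \<open>\<surd>b\<close> on its orthogonal complement.\<close>

definition stretch :: "complex^'n \<Rightarrow> real \<Rightarrow> real \<Rightarrow> complex^'n^'n" where
  "stretch u a b = (\<chi> r c. (if r = c then of_real (sqrt b) else 0) + of_real (sqrt a - sqrt b) * (u $ r * cnj (u $ c)))"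

lemma stretch_mult:
  "stretch u a b *v x = of_real (sqrt b) *s x + (of_real (sqrt a - sqrt b) * cinner u x) *s u"
proof -
  have "(stretch u a b *v x) $ r = of_real (sqrt b) * x $ r + of_real (sqrt a - sqrt b) * cinner u x * u $ r" for r
  proof -
    have "(stretch u a b *v x) $ r = (\<Sum>c\<in>UNIV. (if c = r then of_real (sqrt b) * x $ r else 0) +
        of_real (sqrt a - sqrt b) * u $ r * (cnj (u $ c) * x $ c))"
      unfolding stretch_def matrix_vector_mult_def by (auto intro!: sum.cong simp: algebra_simps)
    also have "\<dots> = of_real (sqrt b) * x $ r + of_real (sqrt a - sqrt b) * u $ r * cinner u x"
      unfolding sum.distrib sum_distrib_left[symmetric] cinner_def by simp
    finally show ?thesis by (simp add: mult_ac)
  qed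
  then show ?thesis by (simp add: vec_eq_iff)
qed

context
  fixes u :: "complex^'n"
  assumes unit: "cinner u u = 1"
begin

lemma cinner_add: "cinner u (x + y) = cinner u x + cinner u y"
  by (simp add: cinner_def algebra_simps sum.distrib)

lemma cinner_scale: "cinner u (c *s x) = c * cinner u x"
  by (simp add: cinner_def sum_distrib_left mult_ac)

lemma stretch_self: "stretch u a b *v u = of_real (sqrt a) *s u"
  by (simp add: stretch_mult unit vec_eq_iff algebra_simps)

lemma stretch_inverse:
  assumes "0 < a" "0 < b"
  shows "stretch u a b ** stretch u (1 / a) (1 / b) = mat 1"
proof -
  have s: "complex_of_real (sqrt a) * complex_of_real (sqrt (1 / a)) = 1"
    "complex_of_real (sqrt b) * complex_of_real (sqrt (1 / b)) = 1"
    using assms by (simp_all add: real_sqrt_divide)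
  have "stretch u a b *v (stretch u (1 / a) (1 / b) *v x) = x" for x
  proof -
    define A B A' B' c where "A = complex_of_real (sqrt a)" and "B = complex_of_real (sqrt b)"
      and "A' = complex_of_real (sqrt (1 / a))" and "B' = complex_of_real (sqrt (1 / b))" and "c = cinner u x"
    have AB: "A * A' = 1" "B * B' = 1" using s by (simp_all add: A_def A'_def B_def B'_def)
    have "stretch u a b *v (stretch u (1 / a) (1 / b) *v x) =
        B *s (B' *s x + ((A' - B') * c) *s u) + ((A - B) * (B' * c + (A' - B') * c)) *s u"
      unfolding stretch_mult cinner_add cinner_scale unit
      by (simp add: A_def B_def A'_def B'_def c_def)
    also have "\<dots> = (B * B') *s x + ((A * A' - B * B') * c) *s u"
      by (simp add: vec_eq_iff algebra_simps)
    finally show ?thesis by (simp add: AB)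
  qed
  then show ?thesis
    by (simp add: matrix_eq matrix_vector_mul_assoc[symmetric])
qed

lemma herm_stretch:
  assumes "0 \<le> a" "0 \<le> b"
  shows "herm (stretch u a b) x = a * (cmod (cinner u x))\<^sup>2 + b * ((norm x)\<^sup>2 - (cmod (cinner u x))\<^sup>2)"
proof -
  define B k c where "B = sqrt b" and "k = sqrt a - sqrt b" and "c = cinner u x"
  have r: "(cmod (of_real B * x $ r + of_real k * c * u $ r))\<^sup>2 =
      B\<^sup>2 * (cmod (x $ r))\<^sup>2 + 2 * B * k * Re (cnj c * (cnj (u $ r) * x $ r)) + k\<^sup>2 * (cmod c)\<^sup>2 * (cmod (u $ r))\<^sup>2" for r
    unfolding cmod_power2 by (simp add: power2_eq_square algebra_simps)
  have uu: "(\<Sum>r\<in>UNIV. (cmod (u $ r))\<^sup>2) = 1"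
  proof -
    have "of_real (\<Sum>r\<in>UNIV. (cmod (u $ r))\<^sup>2) = cinner u u"
      unfolding cinner_def of_real_sum by (intro sum.cong refl) (metis complex_norm_square mult.commute)
    then show ?thesis unfolding unit by (metis of_real_eq_1_iff)
  qed
  have "(\<Sum>r\<in>UNIV. Re (cnj c * (cnj (u $ r) * x $ r))) = Re (cnj c * c)"
    unfolding Re_sum[symmetric] sum_distrib_left[symmetric] c_def cinner_def ..
  also have "cnj c * c = of_real ((cmod c)\<^sup>2)" by (simp only: complex_norm_square mult.commute)
  also have "Re \<dots> = (cmod c)\<^sup>2" by simp
  finally have cr: "(\<Sum>r\<in>UNIV. Re (cnj c * (cnj (u $ r) * x $ r))) = (cmod c)\<^sup>2" .
  have "herm (stretch u a b) x = (\<Sum>r\<in>UNIV. (cmod (of_real B * x $ r + of_real k * c * u $ r))\<^sup>2)"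
    unfolding herm_sum stretch_mult by (simp add: B_def k_def c_def)
  also have "\<dots> = B\<^sup>2 * (norm x)\<^sup>2 + 2 * B * k * (cmod c)\<^sup>2 + k\<^sup>2 * (cmod c)\<^sup>2"
    unfolding r sum.distrib sum_distrib_left[symmetric] uu cr
    by (simp add: norm_vec_def L2_set_def sum_nonneg)
  also have "\<dots> = B\<^sup>2 * (norm x)\<^sup>2 + ((k + B)\<^sup>2 - B\<^sup>2) * (cmod c)\<^sup>2"
    by (simp add: power2_eq_square algebra_simps)
  also have "\<dots> = b * (norm x)\<^sup>2 + (a - b) * (cmod c)\<^sup>2"
    using assms by (simp add: B_def k_def)
  finally show ?thesis by (simp add: c_def algebra_simps)
qed

lemma bessel: "(cmod (cinner u x))\<^sup>2 \<le> (norm x)\<^sup>2"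
  using herm_stretch[of 0 1 x] herm_nonneg[of "stretch u 0 1" x] by simp

lemma herm_stretch_ge:
  assumes "0 \<le> m" "m \<le> a" "m \<le> b"
  shows "m * (norm x)\<^sup>2 \<le> herm (stretch u a b) x"
proof -
  have "m * (cmod (cinner u x))\<^sup>2 \<le> a * (cmod (cinner u x))\<^sup>2" 
    "m * ((norm x)\<^sup>2 - (cmod (cinner u x))\<^sup>2) \<le> b * ((norm x)\<^sup>2 - (cmod (cinner u x))\<^sup>2)"
    using assms bessel[of x] by (auto intro!: mult_right_mono)
  moreover have "m * (norm x)\<^sup>2 = m * (cmod (cinner u x))\<^sup>2 + m * ((norm x)\<^sup>2 - (cmod (cinner u x))\<^sup>2)"
    by (simp only: distrib_left[symmetric]) simp
  moreover have "herm (stretch u a b) x = a * (cmod (cinner u x))\<^sup>2 + b * ((norm x)\<^sup>2 - (cmod (cinner u x))\<^sup>2)"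
    using assms by (intro herm_stretch) auto
  ultimately show ?thesis by linarith
qed

end

section \<open>Monotonicity against equivariance\<close>

lemma image_matrix_eq:
  fixes A B :: "complex^'n^'n"
  assumes "A ** B = mat 1" "B ** A = mat 1"
  shows "(\<lambda>x. A *v x) ` S = {y. B *v y \<in> S}"
proof -
  have inv: "A *v (B *v x) = x" "B *v (A *v x) = x" for x
    by (simp_all add: matrix_vector_mul_assoc assms)
  show ?thesis
  proof (intro set_eqI iffI)
    fix y assume "y \<in> {y. B *v y \<in> S}"
    then show "y \<in> (\<lambda>x. A *v x) ` S" by (intro image_eqI[of y _ "B *v y"]) (simp_all add: inv)
  qed (auto simp: inv)
qed

lemma hermitian_ellipsoid_norm_form:
  fixes E :: "(complex^'n) set"
  assumes "E \<in> hermitian_ellipsoids"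
  shows "\<exists>B :: complex^'n^'n. invertible B \<and> E = {x. norm (B *v x) < 1}"
proof -
  obtain A :: "complex^'n^'n" where A: "invertible A" "E = (\<lambda>x. A *v x) ` ball 0 1"
    using assms unfolding hermitian_ellipsoids_def by blast
  obtain B :: "complex^'n^'n" where B: "A ** B = mat 1" "B ** A = mat 1" using A(1) unfolding invertible_def by blast
  have "E = {x. norm (B *v x) < 1}" unfolding A(2) image_matrix_eq[OF B] by (simp add: ball_def)
  moreover have "invertible B" using B unfolding invertible_def by blast
  ultimately show ?thesis by blast
qed

text \<open>Otherwise a multiple \<open>t x\<close> would have norm \<open>1\<close> for \<open>C\<close> and norm less than \<open>1\<close> for \<open>B\<close>.\<close>

lemma norm_le_of_unit_ball_subset:
  fixes B C :: "complex^'n^'n"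
  assumes "{x. norm (B *v x) < 1} \<subseteq> {x. norm (C *v x) < 1}"
  shows "norm (C *v x) \<le> norm (B *v x)"
proof (rule ccontr)
  assume lt: "\<not> norm (C *v x) \<le> norm (B *v x)"
  define t where "t = 1 / norm (C *v x)"
  have pos: "0 < norm (C *v x)" using lt norm_ge_zero[of "B *v x"] by linarith
  have "norm (B *v (t *\<^sub>R x)) < 1" "norm (C *v (t *\<^sub>R x)) = 1"
    using lt pos by (simp_all add: t_def matrix_vector_scaleR field_simps)
  then show False using assms by force
qed

context
  fixes \<Psi> :: "(complex^'n) set \<Rightarrow> (complex^'n) set"
  assumes ell: "\<Psi> \<in> \<K>' \<rightarrow> hermitian_ellipsoids"
    and equi: "\<And>(A :: complex^'n^'n) Y. invertible A \<Longrightarrow> Y \<in> \<K>' \<Longrightarrow>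
           \<Psi> ((\<lambda>x. A *v x) ` Y) = (\<lambda>x. A *v x) ` \<Psi> Y"
    and pres: "\<And>(S :: (nat \<Rightarrow> complex, nat) charted_space) X.
           complex_manifold S \<Longrightarrow> pseudoconvex_family S X \<Longrightarrow>
           (\<And>s. s \<in> topspace (points S) \<Longrightarrow> fiber X s \<in> \<K>') \<Longrightarrow>
           pseudoconvex_family S (\<Union>s\<in>topspace (points S). {s} \<times> \<Psi> (fiber X s))"
begin

text \<open>The values of \<open>\<Psi>\<close> on the fibers over \<open>0\<close> and over the unit circle are compared. The radius \<open>\<rho> > 1\<close>
  makes the closed unit disc part of the base, so convexity is required a little beyond \<open>t = 1\<close>.\<close>

lemma monotone_along_family:
  assumes P: "quartic P p" "entire_envelope P" and R: "quartic R r" "entire_envelope R"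
    and \<kappa>: "0 < \<kappa>" "\<And>x. \<kappa> * norm x ^ 4 \<le> P x" and \<rho>: "1 < \<rho>"
    and convex: "\<And>t x v. 0 \<le> t \<Longrightarrow> t < \<rho>\<^sup>2 \<Longrightarrow> x \<noteq> 0 \<Longrightarrow> v \<noteq> 0 \<Longrightarrow> 0 < p x v + t * r x v"
  shows "\<Psi> {x. P x + R x < 1} \<subseteq> \<Psi> {x. P x < 1}"
proof -
  have cont: "continuous_on UNIV P" "continuous_on UNIV R"
    using P(1) R(1) by (simp_all add: quartic_def continuous_on_polynomial)
  have zero: "P 0 = 0" "R 0 = 0"
    using quartic_scaleR[OF P(1), of 0 0] quartic_scaleR[OF R(1), of 0 0] by simp_all
  define Y where "Y = (\<lambda>t. {x. P x + t\<^sup>2 * R x < 1})"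
  \<comment> \<open>The value outside the disc is empty, so that every \<open>T t\<close> is star shaped.\<close>
  define T where "T = (\<lambda>t. if 0 \<le> t \<and> t < \<rho> then \<Psi> (Y t) else {})"
  have YK: "Y t \<in> \<K>'" if t: "0 \<le> t" "t < \<rho>" for t
    unfolding Y_def
  proof (rule quartic_sublevel_in_K'[OF quartic_add[OF P(1) quartic_cmult[OF R(1)]] \<kappa>(1)])
    show "\<kappa> * norm x ^ 4 \<le> P x + t\<^sup>2 * R x" for x
      using \<kappa>(2)[of x] mult_nonneg_nonneg[OF zero_le_power2[of t] entire_envelope_nonneg[OF R(2), of x]] by linarith
    have "t\<^sup>2 < \<rho>\<^sup>2" using t by (intro power_strict_mono) auto
    then show "0 < p x v + t\<^sup>2 * r x v" if "x \<noteq> 0" "v \<noteq> 0" for x v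
      using convex[of "t\<^sup>2" x v] that by simp
  qed
  let ?S = "base_disc \<rho>" and ?X = "lift ` sublevel_family P R \<rho>"
  have fib: "fiber ?X s = Y (cmod (s 0))" if "s \<in> topspace (points ?S)" for s
    using fiber_sublevel_family[OF P(2) cont(1) R(2) cont(2) \<kappa> that] by (simp add: Y_def)
  have norm_s: "cmod (s 0) < \<rho>" if "s \<in> topspace (points ?S)" for s
    using that by auto
  have "pseudoconvex_family ?S (\<Union>s\<in>topspace (points ?S). {s} \<times> \<Psi> (fiber ?X s))"
    by (rule pres[OF complex_manifold_base_disc
          pseudoconvex_family_sublevel_family[OF P(2) cont(1) R(2) cont(2) \<kappa> zero]])
       (simp only: fib, rule YK[OF norm_ge_zero norm_s])
  also have "(\<Union>s\<in>topspace (points ?S). {s} \<times> \<Psi> (fiber ?X s)) =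
      (\<Union>s\<in>topspace (points ?S). {s} \<times> T (cmod (s 0)))"
  proof (rule SUP_cong[OF refl])
    fix s assume s: "s \<in> topspace (points ?S)"
    show "{s} \<times> \<Psi> (fiber ?X s) = {s} \<times> T (cmod (s 0))"
      using norm_s[OF s] by (simp add: fib[OF s] T_def)
  qed
  finally have "T 1 \<subseteq> T 0"
  proof (rule rotation_invariant_family_largest_at_center[OF \<rho>])
    fix t \<tau> x assume x: "x \<in> T t" and \<tau>: "0 \<le> \<tau>" "\<tau> \<le> (1::real)"
    then have t: "0 \<le> t" "t < \<rho>" "T t = \<Psi> (Y t)" by (auto simp: T_def split: if_splits)
    then have "\<Psi> (Y t) \<in> hermitian_ellipsoids" using ell YK by blast
    from hermitian_ellipsoid_norm_form[OF this] obtain B :: "complex^'n^'n" where B: "\<Psi> (Y t) = {x. norm (B *v x) < 1}" by blast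
    have "\<tau> * norm (B *v x) \<le> 1 * norm (B *v x)" using \<tau> by (intro mult_right_mono) auto
    then show "\<tau> *\<^sub>R x \<in> T t" using x \<tau> unfolding t(3) B by (simp add: matrix_vector_scaleR)
  qed
  then show ?thesis using \<rho> by (simp add: T_def Y_def)
qed

lemma unit_ball_in_K': "ball 0 1 \<in> (\<K>' :: (complex^'n) set set)"
proof -
  let ?I = "proj_on UNIV :: complex^'n^'n"
  have "(herm ?I x)\<^sup>2 < 1 \<longleftrightarrow> x \<in> ball 0 1" for x :: "complex^'n"
    by (simp add: herm_proj_on_UNIV power_less_one_iff)
  then have "ball 0 1 = {x :: complex^'n. (herm ?I x)\<^sup>2 < 1}" by blast
  moreover have "{x :: complex^'n. (herm ?I x)\<^sup>2 < 1} \<in> \<K>'"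
  proof (rule quartic_sublevel_in_K'[OF quartic_herm_square, of 1])
    show "1 * norm x ^ 4 \<le> (herm ?I x)\<^sup>2" for x :: "complex^'n"
      by (simp add: herm_proj_on_UNIV)
    show "0 < half_hessian ?I x v" if "x \<noteq> 0" "v \<noteq> 0" for x v :: "complex^'n"
    proof -
      have "0 < 2 * herm ?I x * herm ?I v" using that by (simp add: herm_proj_on_UNIV)
      then show ?thesis using half_hessian_bounds(1)[of ?I x v] by linarith
    qed
  qed simp
  ultimately show ?thesis by simp
qed

text \<open>An ellipsoid is a linear image of the ball, so equivariance determines \<open>\<Psi>\<close> on it from \<open>\<Psi>(ball)\<close>.\<close>

lemma Psi_of_ellipsoid:
  fixes L L' :: "complex^'n^'n"
  assumes L: "L ** L' = mat 1" "L' ** L = mat 1" and B: "\<Psi> (ball 0 1) = {x. norm (B *v x) < 1}"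
  shows "\<Psi> {x. (herm L x)\<^sup>2 < 1} = {x. norm ((B ** L) *v x) < 1}"
proof -
  have "{x. (herm L x)\<^sup>2 < 1} = (\<lambda>x. L' *v x) ` ball 0 1"
    unfolding image_matrix_eq[OF L(2,1)] by (simp add: herm_def power_less_one_iff ball_def)
  also have "\<Psi> \<dots> = (\<lambda>x. L' *v x) ` {x. norm (B *v x) < 1}"
    unfolding B[symmetric] by (rule equi[OF _ unit_ball_in_K']) (use L in \<open>auto simp: invertible_def\<close>)
  also have "\<dots> = {x. norm ((B ** L) *v x) < 1}"
    unfolding image_matrix_eq[OF L(2,1)] by (simp add: matrix_vector_mul_assoc)
  finally show ?thesis .
qed

text \<open>The values of the hermitian forms of \<open>\<Psi> {Q < 1}\<close> and \<open>\<Psi>(ball)\<close> are compared at the coordinate vectors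
  and at the diagonals; the resulting inequalities contradict the parallelogram law.\<close>

lemma no_preservation_of_pseudoconvex_families:
  fixes i j :: 'n
  assumes ij: "i \<noteq> j"
  shows False
proof -
  let ?E = "herm (proj_on UNIV) :: complex^'n \<Rightarrow> real"
  let ?N = "\<lambda>k. herm (proj_on {k}) :: complex^'n \<Rightarrow> real"
  define Q where "Q = (\<lambda>x. (?E x)\<^sup>2 + (?N i x)\<^sup>2 + (?N j x)\<^sup>2)"
  define q where "q = (\<lambda>x v. half_hessian (proj_on UNIV) x v + half_hessian (proj_on {i :: 'n}) x v
      + half_hessian (proj_on {j}) x v)"
  have Q: "quartic Q q"
    unfolding Q_def q_def by (intro quartic_add quartic_herm_square)
  have Nk: "?N k x = (cmod (x $ k))\<^sup>2" for k x by (simp add: herm_proj_on)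
  have E: "?E x = (norm x)\<^sup>2" for x by (rule herm_proj_on_UNIV)
  have envelope_sq: "entire_envelope (\<lambda>x. (herm A x)\<^sup>2)" for A :: "complex^'n^'n"
    unfolding power2_eq_square by (intro entire_envelope_mult entire_envelope_herm)
  have Q_env: "entire_envelope Q"
    unfolding Q_def by (intro entire_envelope_add envelope_sq)
  have Q_lower: "1 * norm x ^ 4 \<le> Q x" for x
    by (simp add: Q_def E flip: power_mult)
  have q_lower: "2 * ?E x * ?E v \<le> q x v" for x v
    using half_hessian_bounds(1)[of "proj_on UNIV" x v] half_hessian_nonneg[of "proj_on {i}" x v]
      half_hessian_nonneg[of "proj_on {j}" x v]
    unfolding q_def by linarith
  have q_upper: "q x v \<le> 18 * ?E x * ?E v" for x v
  proof -
    have "?N k x * ?N k v \<le> ?E x * ?E v" for k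
      unfolding E by (intro mult_mono herm_proj_on_le) auto
    from this[of i] this[of j] show ?thesis
      using half_hessian_bounds(2)[of "proj_on UNIV" x v] half_hessian_bounds(2)[of "proj_on {i}" x v]
        half_hessian_bounds(2)[of "proj_on {j}" x v]
      unfolding q_def by linarith
  qed
  have E_pos: "0 < ?E x * ?E v" if "x \<noteq> 0" "v \<noteq> 0" for x v using that by (simp add: E)
  have "{x. Q x < 1} \<in> \<K>'"
  proof (rule quartic_sublevel_in_K'[OF Q _ Q_lower])
    show "0 < q x v" if "x \<noteq> 0" "v \<noteq> 0" for x v
      using q_lower[of x v] E_pos[OF that] by linarith
  qed simp
  then have "\<Psi> {x. Q x < 1} \<in> hermitian_ellipsoids" using ell by blast
  then obtain BQ :: "complex^'n^'n" where BQ: "\<Psi> {x. Q x < 1} = {x. norm (BQ *v x) < 1}"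
    using hermitian_ellipsoid_norm_form by blast
  have "\<Psi> (ball 0 1) \<in> hermitian_ellipsoids" using ell unit_ball_in_K' by blast
  then obtain B :: "complex^'n^'n" where B: "invertible B" "\<Psi> (ball 0 1) = {x. norm (B *v x) < 1}"
    using hermitian_ellipsoid_norm_form by blast
  have Psi_stretch: "\<Psi> {x. (herm (stretch u a b) x)\<^sup>2 < 1} = {x. norm ((B ** stretch u a b) *v x) < 1}"
    if "cinner u u = 1" "0 < a" "0 < b" for u a b
    using Psi_of_ellipsoid[OF stretch_inverse[OF that] _ B(2)] stretch_inverse[OF that(1), of "1 / a" "1 / b"] that by simp
  have at_u: "herm (B ** stretch u a b) u = a * herm B u" if "cinner u u = 1" "0 < a" for u a b
    using that stretch_self[OF that(1), of a b]
    by (simp add: herm_def matrix_vector_mul_assoc[symmetric] vector_scalar_commute norm_scalar_mult power_mult_distrib)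

  have lower: "7 / 5 * herm B (axis k 1) \<le> herm BQ (axis k 1)" if k: "k = i \<or> k = j" for k
  proof -
    let ?u = "axis k 1 :: complex^'n"
    have ip: "cinner ?u x = x $ k" for x
    proof -
      have "cinner ?u x = (\<Sum>c\<in>UNIV. if c = k then x $ k else 0)"
        unfolding cinner_def axis_def by (intro sum.cong refl) auto
      then show ?thesis by simp
    qed
    have unit: "cinner ?u ?u = 1" by (simp add: ip)
    let ?L = "stretch ?u (7 / 5) (5 / 7)"
    obtain k' where k': "k' \<noteq> k" "k' = i \<or> k' = j" using k ij by metis
    \<comment> \<open>The difference \<open>Q - G\<^sup>2\<close> for \<open>G = 7/5 \<bar>x\<^sub>k\<bar>\<^sup>2 + 5/7 y\<close>, \<open>y = \<bar>x\<bar>\<^sup>2 - \<bar>x\<^sub>k\<bar>\<^sup>2\<close>. The choice \<open>7/5 \<cdot> 5/7 = 1\<close>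
      removes the mixed term \<open>\<bar>x\<^sub>k\<bar>\<^sup>2 y\<close>, which leaves a sum of squares of forms, convex for all \<open>t \<ge> 0\<close>.\<close>
    define R where "R = (\<lambda>x. (1 / 25) * (?N k x)\<^sup>2 + (?N k' x)\<^sup>2 + (24 / 49) * (herm (proj_on (- {k})) x)\<^sup>2)"
    define r where "r = (\<lambda>x v. (1 / 25) * half_hessian (proj_on {k}) x v + half_hessian (proj_on {k'}) x v
        + (24 / 49) * half_hessian (proj_on (- {k :: 'n})) x v)"
    have R: "quartic R r"
      unfolding R_def r_def by (intro quartic_add quartic_cmult quartic_herm_square)
    have R_env: "entire_envelope R"
      unfolding R_def by (intro entire_envelope_add entire_envelope_mult[OF entire_envelope_const] envelope_sq) auto
    have L: "herm ?L x = 7 / 5 * ?N k x + 5 / 7 * herm (proj_on (- {k})) x" for x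
    proof -
      have "?E x = ?N k x + herm (proj_on (- {k})) x"
        unfolding herm_proj_on by (simp add: sum.remove[of UNIV k] Compl_eq_Diff_UNIV)
      then show ?thesis using herm_stretch[OF unit, of "7 / 5" "5 / 7" x] by (simp add: ip Nk E)
    qed
    have QR: "Q x = (herm ?L x)\<^sup>2 + R x" for x
    proof -
      have "?E x = ?N k x + herm (proj_on (- {k})) x"
        unfolding herm_proj_on by (simp add: sum.remove[of UNIV k] Compl_eq_Diff_UNIV)
      moreover have "(?N i x)\<^sup>2 + (?N j x)\<^sup>2 = (?N k x)\<^sup>2 + (?N k' x)\<^sup>2"
        using k k' by auto
      ultimately show ?thesis
        unfolding L R_def Q_def by (simp add: power2_eq_square algebra_simps)
    qed
    have L_lower: "5 / 7 * (norm x)\<^sup>2 \<le> herm ?L x" for x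
      by (rule herm_stretch_ge[OF unit]) auto
    have "\<Psi> {x. (herm ?L x)\<^sup>2 + R x < 1} \<subseteq> \<Psi> {x. (herm ?L x)\<^sup>2 < 1}"
    proof (rule monotone_along_family[OF quartic_herm_square envelope_sq R R_env, where \<kappa> = "(5 / 7)\<^sup>2" and \<rho> = 2])
      fix x :: "complex^'n"
      have "(5 / 7 * (norm x)\<^sup>2)\<^sup>2 \<le> (herm ?L x)\<^sup>2" using L_lower[of x] by (intro power_mono) auto
      moreover have "(5 / 7 * (norm x)\<^sup>2)\<^sup>2 = (5 / 7)\<^sup>2 * norm x ^ 4" unfolding power_mult_distrib by simp
      ultimately show "(5 / 7)\<^sup>2 * norm x ^ 4 \<le> (herm ?L x)\<^sup>2" by (simp only:)
    next
      fix t :: real and x v :: "complex^'n" assume "0 \<le> t" "x \<noteq> 0" "v \<noteq> 0"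
      have "0 < herm ?L x" if "x \<noteq> 0" for x
      proof -
        have "0 < 5 / 7 * (norm x)\<^sup>2" using that by simp
        then show ?thesis using L_lower[of x] by linarith
      qed
      then have "0 < 2 * herm ?L x * herm ?L v" using \<open>x \<noteq> 0\<close> \<open>v \<noteq> 0\<close> by simp
      moreover have "0 \<le> t * r x v" unfolding r_def using \<open>0 \<le> t\<close> by (simp add: half_hessian_nonneg)
      ultimately show "0 < half_hessian ?L x v + t * r x v"
        using half_hessian_bounds(1)[of ?L x v] by linarith
    qed simp_all
    then have "\<Psi> {x. Q x < 1} \<subseteq> \<Psi> {x. (herm ?L x)\<^sup>2 < 1}" unfolding QR .
    then have "norm ((B ** ?L) *v ?u) \<le> norm (BQ *v ?u)"
      unfolding BQ Psi_stretch[OF unit, of "7 / 5" "5 / 7", simplified] by (rule norm_le_of_unit_ball_subset)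
    then have "herm (B ** ?L) ?u \<le> herm BQ ?u" by (simp add: herm_def)
    then show ?thesis using at_u[OF unit, of "7 / 5" "5 / 7"] by simp
  qed

  have upper: "herm BQ (axis i 1 + \<epsilon> *s axis j 1) \<le> 4 / 3 * herm B (axis i 1 + \<epsilon> *s axis j 1)"
    if \<epsilon>: "\<epsilon> = 1 \<or> \<epsilon> = -1" for \<epsilon> :: complex
  proof -
    define f where "f = (axis i 1 + \<epsilon> *s axis j 1 :: complex^'n)"
    define s where "s = complex_of_real (1 / sqrt 2)"
    define u where "u = s *s f"
    have ss: "s * s = 1 / 2" "cnj s = s" "cmod s ^ 2 = 1 / 2"
      by (simp_all add: s_def power_divide norm_divide flip: of_real_mult)
    have ee: "\<epsilon> * \<epsilon> = 1" "cnj \<epsilon> = \<epsilon>" using \<epsilon> by auto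
    have ip: "cinner u x = s * (x $ i + \<epsilon> * x $ j)" for x
    proof -
      have "cinner u x = (\<Sum>c\<in>UNIV. (if c = i then s * x $ i else 0) + (if c = j then s * \<epsilon> * x $ j else 0))"
        unfolding cinner_def u_def f_def using ij ss ee by (intro sum.cong refl) (auto simp: axis_def)
      then show ?thesis by (simp add: sum.distrib algebra_simps)
    qed
    have "u $ i = s" "u $ j = s * \<epsilon>" using ij by (simp_all add: u_def f_def axis_def)
    then have "cinner u u = s * s + (\<epsilon> * \<epsilon>) * (s * s)" unfolding ip by (simp add: algebra_simps)
    then have unit: "cinner u u = 1" unfolding ee ss by simp
    let ?L = "stretch u (4 / 3) 2"
    define R where "R = (\<lambda>x. (herm ?L x)\<^sup>2 + (-1) * Q x)"
    define r where "r = (\<lambda>x v. half_hessian ?L x v + (-1) * q x v)"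
    have R: "quartic R r"
      unfolding R_def r_def by (intro quartic_add quartic_cmult quartic_herm_square Q)
    \<comment> \<open>Coordinates adapted to the diagonals: \<open>a / 2\<close> and \<open>b / 2\<close> are the squared moduli of the components of \<open>x\<close> along
      \<open>e\<^sub>i + \<epsilon> e\<^sub>j\<close> and \<open>e\<^sub>i - \<epsilon> e\<^sub>j\<close>. If \<open>p\<close> and \<open>q\<close> are these components, \<open>G\<^sup>2 - Q\<close>
      contains the indefinite term \<open>- Re (p\<^sup>2 cnj q\<^sup>2)\<close>, which the square \<open>\<bar>w\<bar>\<^sup>2\<close> absorbs.\<close>
    define a b z where "a = (\<lambda>x :: complex^'n. (cmod (x $ i + \<epsilon> * x $ j))\<^sup>2)"
      and "b = (\<lambda>x :: complex^'n. (cmod (x $ i - \<epsilon> * x $ j))\<^sup>2)"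
      and "z = (herm (proj_on (- {i, j})) :: complex^'n \<Rightarrow> real)"
    define w where "w = (\<lambda>x :: complex^'n. (x $ i + \<epsilon> * x $ j)\<^sup>2 / 2 - (x $ i - \<epsilon> * x $ j)\<^sup>2)"
    have R_eq: "R x = (cmod (w x))\<^sup>2 / 4 + 1 / 144 * (a x * a x) + 3 / 8 * (b x * b x)
        + 3 * (b x * z x) + 3 * (z x * z x) + 5 / 3 * (a x * z x) + 1 / 3 * (a x * b x)" for x
    proof -
      define g h where "g = x $ i" and "h = \<epsilon> * x $ j"
      define m where "m = Re (g * cnj h)"
      define X Y where "X = (cmod g)\<^sup>2" and "Y = (cmod h)\<^sup>2"
      have N: "?N i x = X" "?N j x = Y" using \<epsilon> by (auto simp: X_def Y_def g_def h_def Nk)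
      have ax: "a x = X + Y + 2 * m" and bx: "b x = X + Y - 2 * m"
        unfolding a_def b_def X_def Y_def m_def g_def[symmetric] h_def[symmetric] cmod_power2
        by (simp_all add: power2_eq_square algebra_simps)
      have Ex: "?E x = X + Y + z x"
        unfolding N[symmetric] z_def herm_proj_on
        using ij by (simp add: sum.remove[of UNIV i] sum.remove[of "UNIV - {i}" j] Compl_eq_Diff_UNIV Diff_insert2[symmetric])
      have "herm ?L x = 2 * ?E x - a x / 3"
        using herm_stretch[OF unit, of "4 / 3" 2 x]
        by (simp add: ip E a_def norm_mult power_mult_distrib ss)
      then have Lx: "herm ?L x = 2 * (X + Y + z x) - a x / 3" by (simp add: Ex)
      have sq: "(cmod (P\<^sup>2 / 2 - S\<^sup>2))\<^sup>2 = (cmod P) ^ 4 / 4 + (cmod S) ^ 4 + (cmod P)\<^sup>2 * (cmod S)\<^sup>2 - 2 * (Re (P * cnj S))\<^sup>2"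
        for P S :: complex
      proof -
        have four: "cmod u ^ 4 = ((Re u)\<^sup>2 + (Im u)\<^sup>2)\<^sup>2" for u :: complex
          unfolding cmod_power2[symmetric] by simp
        show ?thesis
          unfolding four cmod_power2 by (simp add: power2_eq_square field_simps)
      qed
      have "Re ((g + h) * cnj (g - h)) = X - Y"
        unfolding X_def Y_def cmod_power2 by (simp add: power2_eq_square algebra_simps)
      moreover have "cmod (g + h) ^ 4 = (a x)\<^sup>2" "cmod (g - h) ^ 4 = (b x)\<^sup>2"
        by (simp_all add: a_def b_def g_def h_def)
      ultimately have wx: "(cmod (w x))\<^sup>2 = (a x)\<^sup>2 / 4 + (b x)\<^sup>2 + a x * b x - 2 * (X - Y)\<^sup>2"
        using sq[of "g + h" "g - h"] by (simp add: w_def a_def b_def g_def h_def)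
      show ?thesis
        unfolding R_def Q_def N Lx Ex wx ax bx by (simp add: power2_eq_square field_simps)
    qed
    have a_env: "entire_envelope a" and b_env: "entire_envelope b" and z_env: "entire_envelope z"
      unfolding a_def b_def z_def
      by (intro entire_envelope_norm entire_envelope_herm entire_add entire_diff entire_mult entire_const entire_component)+
    have "entire w"
      unfolding w_def power2_eq_square divide_inverse
      by (intro entire_add entire_diff entire_mult entire_const entire_component)
    then have w_env: "entire_envelope (\<lambda>x. (cmod (w x))\<^sup>2)" by (rule entire_envelope_norm)
    have R_env: "entire_envelope R"
      unfolding R_eq[abs_def] divide_inverse
      by (intro entire_envelope_add entire_envelope_mult entire_envelope_const a_env b_env z_env w_env) auto
    have L_lower: "4 / 3 * ?E x \<le> herm ?L x" for x
      unfolding E by (rule herm_stretch_ge[OF unit]) auto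
    have "\<Psi> {x. Q x + R x < 1} \<subseteq> \<Psi> {x. Q x < 1}"
    proof (rule monotone_along_family[OF Q Q_env R R_env _ Q_lower, where \<rho> = "21 / 20"])
      fix t :: real and x v :: "complex^'n" assume t: "0 \<le> t" "t < (21 / 20)\<^sup>2" and xv: "x \<noteq> 0" "v \<noteq> 0"
      have "4 / 3 * ?E x * (4 / 3 * ?E v) \<le> herm ?L x * herm ?L v"
        by (intro mult_mono L_lower) (auto simp: E)
      then have Lq: "32 / 9 * (?E x * ?E v) \<le> half_hessian ?L x v"
        using half_hessian_bounds(1)[of ?L x v] by linarith
      \<comment> \<open>Up to \<open>t = 1\<close> this is a convex combination of positive terms. Slightly beyond, the negative multiple of
        \<open>q\<close> is outweighed: \<open>18 (t - 1) < 32/9\<close> for \<open>t < (21/20)\<^sup>2\<close>, where \<open>32/9 = 2 (4/3)\<^sup>2\<close>.\<close>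
      have "0 < (1 - t) * q x v + t * half_hessian ?L x v"
      proof (cases "t \<le> 1")
        case True
        have "(1 - t) * (2 * (?E x * ?E v)) + t * (2 * (?E x * ?E v)) \<le> (1 - t) * q x v + t * half_hessian ?L x v"
          using True t(1) Lq q_lower[of x v] E_pos[OF xv] by (intro add_mono mult_left_mono) auto
        moreover have "(1 - t) * c + t * c = c" for c :: real by (simp add: algebra_simps)
        moreover have "0 < 2 * (?E x * ?E v)" using E_pos[OF xv] by (rule mult_pos_pos[OF zero_less_numeral])
        ultimately show ?thesis by (metis less_le_trans)
      next
        case False
        have "(t - 1) * q x v \<le> (t - 1) * (18 * (?E x * ?E v))"
          using False q_upper[of x v] by (intro mult_left_mono) auto
        also have "\<dots> \<le> (41 / 400) * (18 * (?E x * ?E v))"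
          using t(2) E_pos[OF xv] by (intro mult_right_mono) (auto simp: power2_eq_square)
        also have "\<dots> < 1 * (32 / 9 * (?E x * ?E v))" using E_pos[OF xv] by linarith
        also have "\<dots> \<le> t * half_hessian ?L x v"
          using False Lq E_pos[OF xv] by (intro mult_mono) auto
        finally show ?thesis by (simp add: algebra_simps)
      qed
      then show "0 < q x v + t * r x v" by (simp add: r_def algebra_simps)
    qed simp_all
    then have "\<Psi> {x. (herm ?L x)\<^sup>2 < 1} \<subseteq> \<Psi> {x. Q x < 1}" by (simp add: R_def)
    then have "norm (BQ *v u) \<le> norm ((B ** ?L) *v u)"
      unfolding BQ Psi_stretch[OF unit, of "4 / 3" 2, simplified] by (rule norm_le_of_unit_ball_subset)
    then have "herm BQ u \<le> herm (B ** ?L) u" by (simp add: herm_def)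
    then have "herm BQ u \<le> 4 / 3 * herm B u" using at_u[OF unit, of "4 / 3" 2] by simp
    moreover have "herm A u = herm A f / 2" for A :: "complex^'n^'n"
      by (simp add: u_def herm_def vector_scalar_commute norm_scalar_mult power_mult_distrib ss)
    ultimately show ?thesis by (simp add: f_def)
  qed

  have parallelogram: "herm A (axis i 1 + 1 *s axis j 1) + herm A (axis i 1 + (-1) *s axis j 1) =
      2 * herm A (axis i 1) + 2 * herm A (axis j 1)" for A :: "complex^'n^'n"
    unfolding herm_def power2_norm_eq_inner
    by (simp add: matrix_vector_right_distrib matrix_vector_mult_diff_distrib inner_add inner_diff)
  have "herm B (axis i 1) > 0"
  proof -
    have "B *v axis i 1 \<noteq> 0"
      using B(1) by (metis invertible_def matrix_vector_mul_assoc matrix_vector_mul_lid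
          matrix_vector_mult_0_right axis_eq_0_iff one_neq_zero)
    then show ?thesis by (simp add: herm_def)
  qed
  then show False
    using upper[of 1] upper[of "-1"] lower[of i] lower[of j] parallelogram[of B] parallelogram[of BQ]
      herm_nonneg[of B "axis j 1"] by simp
qed

end

theorem theorem4p1:
  fixes \<Psi> :: "(complex^'n) set \<Rightarrow> (complex^'n) set"
  assumes "CARD('n) \<ge> 2"
    and "\<Psi> \<in> \<K>' \<rightarrow> hermitian_ellipsoids"
    and "\<And>(A :: complex^'n^'n) Y. invertible A \<Longrightarrow> Y \<in> \<K>' \<Longrightarrow>
           \<Psi> ((\<lambda>x. A *v x) ` Y) = (\<lambda>x. A *v x) ` \<Psi> Y"
  shows "\<exists>(S :: (nat \<Rightarrow> complex, nat) charted_space) (X :: ((nat \<Rightarrow> complex) \<times> (complex^'n)) set).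
           complex_manifold S \<and> pseudoconvex_family S X \<and>
           (\<forall>s\<in>topspace (points S). fiber X s \<in> \<K>') \<and>
           \<not> pseudoconvex_family S (\<Union>s\<in>topspace (points S). {s} \<times> \<Psi> (fiber X s))"
proof (rule ccontr)
  assume "\<not> ?thesis"
  then have pres: "pseudoconvex_family S (\<Union>s\<in>topspace (points S). {s} \<times> \<Psi> (fiber X s))"
    if "complex_manifold S" "pseudoconvex_family S X" "\<And>s. s \<in> topspace (points S) \<Longrightarrow> fiber X s \<in> \<K>'"
    for S :: "(nat \<Rightarrow> complex, nat) charted_space" and X
    using that by blast
  have "card (UNIV :: 'n set) \<noteq> 1" using assms(1) by simp
  then obtain i j :: 'n where "i \<noteq> j"
    by (metis UNIV_I card_1_singleton_iff insertI1 is_singletonI' is_singleton_altdef singletonD empty_not_UNIV)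
  show False
  proof (rule no_preservation_of_pseudoconvex_families[of \<Psi>])
    show "\<Psi> \<in> \<K>' \<rightarrow> hermitian_ellipsoids" by (rule assms(2))
    show "i \<noteq> j" by fact
  qed (fact assms(3) pres)+
qed

end
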